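(* Let $\eta>0$ and $\sigma>0$. Then the Hilbert space $\mathbb F_{\eta,\sigma}(\mathbb C)$ is the closed subspace of $L^2(\mathbb C,\lambda_{\eta,\sigma})$ constructed as the closure of the space $\mathcal P(\mathbb C)$ of complex polynomials. Furthermore, the density $\Lambda_{\eta,\sigma}$ of $\lambda_{\eta,\sigma}$ with respect to the Lebesgue measure on $\mathbb C$ satisfies $$\Lambda_{\eta,\sigma}(z)=\frac{2\,\eta^{-\frac12(1+\frac\sigma\eta)}}{\pi\,\Gamma(\frac\sigma\eta)}\,|z|^{\frac\sigma\eta-1}\,K_{1-\frac\sigma\eta}\big(2\eta^{-\frac12}|z|\big).$$
   Context: For $z,h\in\mathbb C$: $(z\mid h)_0=1$, $(z\mid h)_n=z(z-h)\cdots(z-(n-1)h)$. $\mathbb F_{\eta,\sigma}(\mathbb C)$ is the Hilbert space of all entire functions $\varphi(z)=\sum_{n\ge0}f_nz^n$ with $\sum_n|f_n|^2\,n!\,(\sigma\mid-\eta)_n<\infty$, with inner product $(\varphi,\psi)=\sum_nf_n\overline{g_n}\,n!\,(\sigma\mid-\eta)_n$ for $\psi(z)=\sum_ng_nz^n$. For $r>0$, $\nu_r(dz)=\frac1{\pi r}\exp(-|z|^2/r)\,dA(z)$, with $dA$ the Lebesgue measure on $\mathbb C$. Let $\mu_{\eta,\eta,\eta\sigma}(dr)=\frac1{\Gamma(\sigma/\eta)}\eta^{-\sigma/\eta}\,r^{-1+\sigma/\eta}e^{-r/\eta}\,dr$ on $(0,\infty)$ (a gamma distribution). Define the probability measure on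 $\mathbb C$ $$\lambda_{\eta,\sigma}(dz)=\int_{(0,\infty)}\nu_r(dz)\,\mu_{\eta,\eta,\eta\sigma}(dr)=\Lambda_{\eta,\sigma}(z)\,dA(z),$$ $$\Lambda_{\eta,\sigma}(z)=\frac{1}{\pi\Gamma(\sigma/\eta)}\,\eta^{-\sigma/\eta}\int_0^\infty\exp\Big(-\frac{|z|^2}{r}-\frac r\eta\Big)r^{-2+\sigma/\eta}\,dr.$$ $K_\theta$ is the modified Bessel function: $K_\theta(x)=\frac{\pi}{2\sin(\theta\pi)}(I_{-\theta}(x)-I_\theta(x))$ with $I_\theta(x)=(x/2)^\theta\sum_{n\ge0}\frac{(x/2)^{2n}}{n!\,\Gamma(\theta+n+1)}$ for $\theta\notin\mathbb Z$, and defined by the limit in $\theta$ for integer $\theta$. *)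

theory Defs
  imports "HOL-Complex_Analysis.Complex_Analysis" "HOL-Probability.Probability"
begin

definition gen_factorial :: "'a::comm_ring_1 \<Rightarrow> 'a \<Rightarrow> nat \<Rightarrow> 'a" where
  "gen_factorial z h n = (\<Prod>k<n. z - of_nat k * h)"


subsection \<open>The Hilbert space of entire functions\<close>

text \<open>\<open>fps_nth (fps_expansion \<phi> 0) n\<close> is the \<open>n\<close>-th Taylor coefficient of \<open>\<phi>\<close> at \<open>0\<close>.\<close>

definition fock_space :: "real \<Rightarrow> real \<Rightarrow> (complex \<Rightarrow> complex) set" where
  "fock_space \<eta> \<sigma> = {\<phi>. \<phi> holomorphic_on UNIV \<and>
     summable (\<lambda>n. (cmod (fps_nth (fps_expansion \<phi> 0) n))\<^sup>2 * fact n * gen_factorial \<sigma> (- \<eta>) n)}"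

definition fock_inner :: "real \<Rightarrow> real \<Rightarrow> (complex \<Rightarrow> complex) \<Rightarrow> (complex \<Rightarrow> complex) \<Rightarrow> complex" where
  "fock_inner \<eta> \<sigma> \<phi> \<psi> = (\<Sum>n. fps_nth (fps_expansion \<phi> 0) n * cnj (fps_nth (fps_expansion \<psi> 0) n)
     * fact n * of_real (gen_factorial \<sigma> (- \<eta>) n))"


text \<open>The sum in \<^const>\<open>fock_inner\<close> converges absolutely on \<^const>\<open>fock_space\<close>.\<close>

lemma summable_fock_inner:
  assumes "\<eta> > 0" "\<sigma> > 0" and "\<phi> \<in> fock_space \<eta> \<sigma>" "\<psi> \<in> fock_space \<eta> \<sigma>"
  shows "summable (\<lambda>n. norm (fps_nth (fps_expansion \<phi> 0) n * cnj (fps_nth (fps_expansion \<psi> 0) n)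
     * fact n * of_real (gen_factorial \<sigma> (- \<eta>) n)))"
proof -
  let ?f = "\<lambda>n. cmod (fps_nth (fps_expansion \<phi> 0) n)" and ?g = "\<lambda>n. cmod (fps_nth (fps_expansion \<psi> 0) n)"
  let ?w = "\<lambda>n. fact n * gen_factorial \<sigma> (- \<eta>) n"
  have w: "gen_factorial \<sigma> (- \<eta>) n \<ge> 0" for n
    using assms by (auto simp: gen_factorial_def intro!: prod_nonneg)
  have ab: "a * b \<le> a\<^sup>2 + b\<^sup>2" if "a \<ge> 0" "b \<ge> 0" for a b :: real
    using that sum_squares_bound[of a b] mult_nonneg_nonneg[of a b] by linarith
  have "summable (\<lambda>n. (?f n)\<^sup>2 * ?w n)" "summable (\<lambda>n. (?g n)\<^sup>2 * ?w n)"
    using assms(3,4) unfolding fock_space_def by (simp_all only: mem_Collect_eq mult.assoc)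
  note sum = summable_add[OF this]
  have le: "?f n * ?g n * ?w n \<le> (?f n)\<^sup>2 * ?w n + (?g n)\<^sup>2 * ?w n" for n
  proof -
    have "?f n * ?g n * ?w n \<le> ((?f n)\<^sup>2 + (?g n)\<^sup>2) * ?w n"
      using w[of n] by (intro mult_right_mono ab) simp_all
    then show ?thesis
      by (simp only: distrib_right)
  qed
  have eq: "norm (norm (fps_nth (fps_expansion \<phi> 0) n * cnj (fps_nth (fps_expansion \<psi> 0) n)
      * fact n * of_real (gen_factorial \<sigma> (- \<eta>) n))) = ?f n * ?g n * ?w n" for n
    using w[of n] by (simp add: norm_mult)
  show ?thesis
    by (rule summable_comparison_test'[OF sum, of 0]) (simp only: eq le)
qed


subsection \<open>The measures\<close>

text \<open>For \<open>r \<le> 0\<close> the density below is truncated to \<open>0\<close> by \<^const>\<open>ennreal\<close>, so that \<open>nu_measure r\<close>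
  is then the null measure; only \<open>r > 0\<close> matters for the mixture.\<close>

definition nu_measure :: "real \<Rightarrow> complex measure" where
  "nu_measure r = density lborel (\<lambda>z. ennreal (1 / (pi * r) * exp (- (cmod z)\<^sup>2 / r)))"

definition mu_measure :: "real \<Rightarrow> real \<Rightarrow> real measure" where
  "mu_measure \<eta> \<sigma> = density lborel (\<lambda>r. ennreal (1 / Gamma (\<sigma> / \<eta>) * \<eta> powr (- \<sigma> / \<eta>)
     * r powr (-1 + \<sigma> / \<eta>) * exp (- r / \<eta>)) * indicator {0<..} r)"

text \<open>The mixture of the \<^const>\<open>nu_measure\<close>s, as the bind operation of the Giry monad.\<close>

definition lambda_measure :: "real \<Rightarrow> real \<Rightarrow> complex measure" where
  "lambda_measure \<eta> \<sigma> = Giry_Monad.bind (mu_measure \<eta> \<sigma>) nu_measure"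

text \<open>The integral is taken in \<open>[0, \<infinity>]\<close>; it is infinite exactly for \<open>z = 0\<close> and \<open>\<sigma> \<le> \<eta>\<close>.\<close>

definition lambda_density :: "real \<Rightarrow> real \<Rightarrow> complex \<Rightarrow> ennreal" where
  "lambda_density \<eta> \<sigma> z = ennreal (1 / (pi * Gamma (\<sigma> / \<eta>)) * \<eta> powr (- \<sigma> / \<eta>))
     * (\<integral>\<^sup>+ r \<in> {0<..}. ennreal (exp (- (cmod z)\<^sup>2 / r - r / \<eta>) * r powr (-2 + \<sigma> / \<eta>)) \<partial>lborel)"


subsection \<open>Modified Bessel functions\<close>

definition bessel_I :: "real \<Rightarrow> real \<Rightarrow> real" where
  "bessel_I \<theta> x = (x / 2) powr \<theta> * (\<Sum>n. (x / 2) ^ (2 * n) / (fact n * Gamma (\<theta> + real n + 1)))"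

definition bessel_K :: "real \<Rightarrow> real \<Rightarrow> real" where
  "bessel_K \<theta> x =
     (let K = (\<lambda>t. pi / (2 * sin (t * pi)) * (bessel_I (- t) x - bessel_I t x))
      in if \<theta> \<notin> \<int> then K \<theta> else Lim (at \<theta>) K)"


subsection \<open>The space \<open>L\<^sup>2\<close> of a measure\<close>

definition L2_fun :: "'a measure \<Rightarrow> ('a \<Rightarrow> complex) set" where
  "L2_fun M = {f \<in> borel_measurable M. integrable M (\<lambda>x. (cmod (f x))\<^sup>2)}"

definition L2_inner :: "'a measure \<Rightarrow> ('a \<Rightarrow> complex) \<Rightarrow> ('a \<Rightarrow> complex) \<Rightarrow> complex" where
  "L2_inner M f g = (\<integral>x. f x * cnj (g x) \<partial>M)"

definition L2_norm :: "'a measure \<Rightarrow> ('a \<Rightarrow> complex) \<Rightarrow> real" where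
  "L2_norm M f = sqrt (\<integral>x. (cmod (f x))\<^sup>2 \<partial>M)"

definition L2_class :: "'a measure \<Rightarrow> ('a \<Rightarrow> complex) \<Rightarrow> ('a \<Rightarrow> complex) set" where
  "L2_class M f = {g \<in> L2_fun M. AE x in M. g x = f x}"

definition L2_space :: "'a measure \<Rightarrow> ('a \<Rightarrow> complex) set set" where
  "L2_space M = L2_class M ` L2_fun M"

text \<open>Independent of the chosen representatives, see \<open>L2_dist_class\<close> below.\<close>

definition L2_dist :: "'a measure \<Rightarrow> ('a \<Rightarrow> complex) set \<Rightarrow> ('a \<Rightarrow> complex) set \<Rightarrow> real" where
  "L2_dist M A B = L2_norm M (\<lambda>x. (SOME f. f \<in> A) x - (SOME g. g \<in> B) x)"

definition L2_topology :: "'a measure \<Rightarrow> ('a \<Rightarrow> complex) set topology" where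
  "L2_topology M = Metric_space.mtopology (L2_space M) (L2_dist M)"

lemma L2_class_rep:
  assumes "f \<in> L2_fun M"
  shows "(SOME g. g \<in> L2_class M f) \<in> L2_fun M" "AE x in M. (SOME g. g \<in> L2_class M f) x = f x"
proof -
  have "f \<in> L2_class M f"
    using assms by (simp add: L2_class_def)
  then have "(SOME g. g \<in> L2_class M f) \<in> L2_class M f"
    by (rule someI[where P = "\<lambda>g. g \<in> L2_class M f"])
  then show "(SOME g. g \<in> L2_class M f) \<in> L2_fun M" "AE x in M. (SOME g. g \<in> L2_class M f) x = f x"
    by (auto simp: L2_class_def)
qed

lemma L2_dist_class:
  assumes f: "f \<in> L2_fun M" and g: "g \<in> L2_fun M"
  shows "L2_dist M (L2_class M f) (L2_class M g) = L2_norm M (\<lambda>x. f x - g x)"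
proof -
  let ?f = "SOME h. h \<in> L2_class M f" and ?g = "SOME h. h \<in> L2_class M g"
  note [measurable] = L2_class_rep(1)[OF f, unfolded L2_fun_def, simplified, THEN conjunct1]
    L2_class_rep(1)[OF g, unfolded L2_fun_def, simplified, THEN conjunct1]
  have [measurable]: "f \<in> borel_measurable M" "g \<in> borel_measurable M"
    using f g by (auto simp: L2_fun_def)
  have "(\<integral>x. (cmod (?f x - ?g x))\<^sup>2 \<partial>M) = (\<integral>x. (cmod (f x - g x))\<^sup>2 \<partial>M)"
  proof (rule integral_cong_AE)
    show "AE x in M. (cmod (?f x - ?g x))\<^sup>2 = (cmod (f x - g x))\<^sup>2"
      using L2_class_rep(2)[OF f] L2_class_rep(2)[OF g] by eventually_elim simp
  qed measurable
  then show ?thesis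
    by (simp add: L2_dist_def L2_norm_def)
qed

lemma L2_class_eq_iff:
  assumes "f \<in> L2_fun M" "g \<in> L2_fun M"
  shows "L2_class M f = L2_class M g \<longleftrightarrow> (AE x in M. f x = g x)"
proof
  assume "L2_class M f = L2_class M g"
  moreover have "f \<in> L2_class M f"
    using assms by (simp add: L2_class_def)
  ultimately show "AE x in M. f x = g x"
    by (auto simp: L2_class_def)
next
  assume *: "AE x in M. f x = g x"
  have "(AE x in M. h x = f x) \<longleftrightarrow> (AE x in M. h x = g x)" for h
  proof
    show "AE x in M. h x = g x" if "AE x in M. h x = f x"
      using that * by eventually_elim simp
    show "AE x in M. h x = f x" if "AE x in M. h x = g x"
      using that * by eventually_elim simp
  qed
  then show "L2_class M f = L2_class M g"
    by (auto simp: L2_class_def)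
qed

lemma L2_integrable_mult:
  assumes "f \<in> L2_fun M" "g \<in> L2_fun M"
  shows "integrable M (\<lambda>x. cmod (f x) * cmod (g x))"
proof (rule Bochner_Integration.integrable_bound)
  show "integrable M (\<lambda>x. (cmod (f x))\<^sup>2 + (cmod (g x))\<^sup>2)"
    using assms by (auto simp: L2_fun_def)
  show "(\<lambda>x. cmod (f x) * cmod (g x)) \<in> borel_measurable M"
    using assms by (auto simp: L2_fun_def)
  have "a * b \<le> a\<^sup>2 + b\<^sup>2" if "a \<ge> 0" "b \<ge> 0" for a b :: real
    using that sum_squares_bound[of a b] mult_nonneg_nonneg[of a b] by linarith
  then show "AE x in M. norm (cmod (f x) * cmod (g x)) \<le> norm ((cmod (f x))\<^sup>2 + (cmod (g x))\<^sup>2)"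
    by (intro AE_I2) (auto simp: abs_mult)
qed

lemma L2_fun_diff:
  assumes "f \<in> L2_fun M" "g \<in> L2_fun M"
  shows "(\<lambda>x. f x - g x) \<in> L2_fun M"
proof -
  have "integrable M (\<lambda>x. (cmod (f x - g x))\<^sup>2)"
  proof (rule Bochner_Integration.integrable_bound)
    show "integrable M (\<lambda>x. (cmod (f x))\<^sup>2 + 2 * (cmod (f x) * cmod (g x)) + (cmod (g x))\<^sup>2)"
      using assms L2_integrable_mult[OF assms] by (auto simp: L2_fun_def)
    show "(\<lambda>x. (cmod (f x - g x))\<^sup>2) \<in> borel_measurable M"
      using assms by (auto simp: L2_fun_def)
    have "(cmod (f x - g x))\<^sup>2 \<le> (cmod (f x) + cmod (g x))\<^sup>2" for x
      by (intro power_mono norm_triangle_ineq4) auto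
    then show "AE x in M. norm ((cmod (f x - g x))\<^sup>2)
        \<le> norm ((cmod (f x))\<^sup>2 + 2 * (cmod (f x) * cmod (g x)) + (cmod (g x))\<^sup>2)"
      by (intro AE_I2) (simp add: power2_sum algebra_simps)
  qed
  then show ?thesis
    using assms by (auto simp: L2_fun_def)
qed

lemma L2_norm_triangle:
  assumes f: "f \<in> L2_fun M" and g: "g \<in> L2_fun M"
  shows "L2_norm M (\<lambda>x. f x - g x) \<le> L2_norm M f + L2_norm M g"
proof -
  let ?a = "\<integral>x. (cmod (f x))\<^sup>2 \<partial>M" and ?b = "\<integral>x. (cmod (g x))\<^sup>2 \<partial>M"
  let ?c = "\<integral>x. cmod (f x) * cmod (g x) \<partial>M"
  note int = L2_integrable_mult[OF f g] L2_fun_diff[OF f g]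
  have nn: "?a \<ge> 0" "?b \<ge> 0" "?c \<ge> 0"
    by auto
  have quad: "0 \<le> s\<^sup>2 * ?a - 2 * s * t * ?c + t\<^sup>2 * ?b" for s t
  proof -
    have "0 \<le> (\<integral>x. (s * cmod (f x) - t * cmod (g x))\<^sup>2 \<partial>M)"
      by simp
    also have "\<dots> = (\<integral>x. s\<^sup>2 * (cmod (f x))\<^sup>2 - 2 * s * t * (cmod (f x) * cmod (g x)) + t\<^sup>2 * (cmod (g x))\<^sup>2 \<partial>M)"
      by (simp add: power2_diff power_mult_distrib algebra_simps)
    also have "\<dots> = s\<^sup>2 * ?a - 2 * s * t * ?c + t\<^sup>2 * ?b"
      using f g int by (simp add: L2_fun_def)
    finally show ?thesis .
  qed
  have "?c\<^sup>2 \<le> ?a * ?b"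
  proof (cases "?a = 0")
    case True
    have "?c = 0"
    proof (rule ccontr)
      assume "?c \<noteq> 0"
      then show False
        using quad[of "(?b + 1) / (2 * ?c)" 1] True by simp
    qed
    then show ?thesis using True by simp
  next
    case False
    then have "0 < ?a" using nn by linarith
    have "0 \<le> ?a * (?a * ?b - ?c\<^sup>2)"
      using quad[of ?c ?a] by (simp add: power2_eq_square algebra_simps)
    then show ?thesis
      using \<open>0 < ?a\<close> by (simp add: zero_le_mult_iff)
  qed
  then have c: "?c \<le> sqrt ?a * sqrt ?b"
    by (metis real_le_rsqrt real_sqrt_mult)
  have "(\<integral>x. (cmod (f x - g x))\<^sup>2 \<partial>M)
      \<le> (\<integral>x. (cmod (f x))\<^sup>2 + 2 * (cmod (f x) * cmod (g x)) + (cmod (g x))\<^sup>2 \<partial>M)"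
  proof (rule integral_mono)
    fix x
    have "(cmod (f x - g x))\<^sup>2 \<le> (cmod (f x) + cmod (g x))\<^sup>2"
      by (intro power_mono norm_triangle_ineq4) auto
    then show "(cmod (f x - g x))\<^sup>2 \<le> (cmod (f x))\<^sup>2 + 2 * (cmod (f x) * cmod (g x)) + (cmod (g x))\<^sup>2"
      by (simp add: power2_sum algebra_simps)
  qed (use f g int in \<open>auto simp: L2_fun_def\<close>)
  also have "\<dots> = ?a + 2 * ?c + ?b"
    using f g int by (simp add: L2_fun_def)
  also have "\<dots> \<le> (sqrt ?a + sqrt ?b)\<^sup>2"
    using c nn by (simp add: power2_sum)
  finally show ?thesis
    using nn by (simp add: L2_norm_def real_le_lsqrt)
qed

lemma Metric_space_L2: "Metric_space (L2_space M) (L2_dist M)"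
proof
  show "0 \<le> L2_dist M A B" for A B
    by (simp add: L2_dist_def L2_norm_def)
  show "L2_dist M A B = L2_dist M B A" for A B
    by (simp add: L2_dist_def L2_norm_def norm_minus_commute)
next
  fix A B
  assume "A \<in> L2_space M" "B \<in> L2_space M"
  then obtain f g where fg: "f \<in> L2_fun M" "g \<in> L2_fun M" and AB: "A = L2_class M f" "B = L2_class M g"
    by (auto simp: L2_space_def)
  have "L2_dist M A B = 0 \<longleftrightarrow> (\<integral>x. (cmod (f x - g x))\<^sup>2 \<partial>M) = 0"
    by (simp add: AB L2_dist_class fg L2_norm_def)
  also have "\<dots> \<longleftrightarrow> (AE x in M. f x = g x)"
    using L2_fun_diff[OF fg] by (subst integral_nonneg_eq_0_iff_AE) (auto simp: L2_fun_def)
  finally show "L2_dist M A B = 0 \<longleftrightarrow> A = B"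
    by (simp add: AB L2_class_eq_iff fg)
next
  fix A B C
  assume "A \<in> L2_space M" "B \<in> L2_space M" "C \<in> L2_space M"
  then obtain f g h where *: "f \<in> L2_fun M" "g \<in> L2_fun M" "h \<in> L2_fun M"
    and ABC: "A = L2_class M f" "B = L2_class M g" "C = L2_class M h"
    by (auto simp: L2_space_def)
  have "L2_norm M (\<lambda>x. (f x - g x) - (h x - g x))
      \<le> L2_norm M (\<lambda>x. f x - g x) + L2_norm M (\<lambda>x. h x - g x)"
    using * by (intro L2_norm_triangle L2_fun_diff)
  moreover have "L2_norm M (\<lambda>x. h x - g x) = L2_norm M (\<lambda>x. g x - h x)"
    by (simp add: L2_norm_def norm_minus_commute)
  ultimately show "L2_dist M A C \<le> L2_dist M A B + L2_dist M B C"
    by (simp add: ABC L2_dist_class *)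
qed

end

theory Submission
  imports Defs
begin

text \<open>
  Under a radial probability measure on the plane the monomials are orthogonal. Integrating
  \<open>\<bar>z\<bar>\<^sup>2\<^sup>n\<close> first against the Gaussian and then against the gamma distribution gives
  \<open>n! (\<sigma> | -\<eta>)\<^sub>n\<close>, which is the weight of \<open>\<F>\<close>. Fatou's lemma applied to Taylor
  partial sums turns this into the isometry, and an \<open>L\<^sup>2\<close> limit \<open>f\<close> of polynomials is recovered as
  the entire function with Taylor coefficients \<open>\<langle>f, z\<^sup>n\<rangle> / \<parallel>z\<^sup>n\<parallel>\<^sup>2\<close>, since its Taylor polynomials are the
  best polynomial approximations of \<open>f\<close>.

  For the Bessel form, the substitution \<open>r = \<eta> t\<close> reduces the density to
  \<open>F\<^sub>\<nu>(s) = \<integral> exp (- s / t - t) t powr (\<nu> - 1) dt\<close> over \<open>t > 0\<close>, with \<open>\<nu> = \<sigma> / \<eta> - 1\<close> and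
  \<open>s = \<bar>z\<bar>\<^sup>2 / \<eta>\<close>. Both \<open>F\<^sub>\<nu>\<close> and the combination \<open>G\<^sub>\<nu>\<close> of \<open>I\<^sub>\<nu>\<close> and \<open>I\<^bsub>-\<nu>\<^esub>\<close> that defines \<open>K\<close>
  satisfy \<open>X\<^sub>\<nu>' = - X\<^bsub>\<nu>-1\<^esub>\<close> and \<open>X\<^sub>\<nu> = s powr \<nu> * X\<^bsub>-\<nu>\<^esub>\<close>. For \<open>0 < \<nu> < 1\<close> both tend to \<open>\<Gamma>(\<nu>)\<close>
  at \<open>0\<close>, and the pair of indices \<open>\<nu>\<close>, \<open>1 - \<nu>\<close> gives a closed first-order system, so that \<open>F\<^sub>\<nu> = G\<^sub>\<nu>\<close>.
  Differentiation and the symmetry extend this to all \<open>\<nu> \<notin> \<int>\<close>, and continuity in \<open>\<nu>\<close> (a finite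
  convex function) gives the integers.
\<close>

section \<open>The series of the modified Bessel functions\<close>

text \<open>For \<open>s > 0\<close> this is \<open>s powr (- \<nu> / 2)\<close> times the modified
  Bessel function of the first kind at \<open>2 * sqrt s\<close>. With the entire function
  \<open>rGamma\<close>, coefficients at poles of Gamma are simply zero, so every real order is
  covered.\<close>

definition rgamma_series :: "real \<Rightarrow> real \<Rightarrow> real" where
  "rgamma_series \<nu> s = (\<Sum>n. rGamma (\<nu> + real n + 1) / fact n * s ^ n)"

lemma summable_rgamma_series: "summable (\<lambda>n. rGamma (\<nu> + real n + 1) / fact n * s ^ n)"
proof (rule summable_ratio_test)
  \<comment> \<open>From this index on \<open>\<nu> + real n + 1\<close> is at least
    \<open>2 * \<bar>s\<bar>\<close>, which makes the ratio of consecutive terms at most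
    1/2.\<close>
  define N where "N = nat \<lceil>\<bar>\<nu>\<bar> + 2 * \<bar>s\<bar>\<rceil>"
  fix n assume "n \<ge> N"
  then have n: "real n \<ge> \<bar>\<nu>\<bar> + 2 * \<bar>s\<bar>"
    unfolding N_def by linarith
  \<comment> \<open>Both consecutive terms are expressed by the value at the higher index, because
    \<open>rGamma x = x * rGamma (x + 1)\<close> involves no division and survives zeros of
    \<open>rGamma\<close>.\<close>
  define r where "r = rGamma (\<nu> + real n + 2)"
  have "\<bar>s\<bar> * 2 \<le> (\<nu> + real n + 1) * (real n + 1)"
  proof -
    have "\<bar>s\<bar> * 2 \<le> \<nu> + real n + 1" using n by linarith
    also have "\<dots> \<le> (\<nu> + real n + 1) * (real n + 1)"
      using n by (simp add: mult_le_cancel_left1)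
    finally show ?thesis .
  qed
  then have "\<bar>s\<bar> / (real n + 1) \<le> 1 / 2 * \<bar>\<nu> + real n + 1\<bar>"
    using n by (simp add: field_simps)
  then have "\<bar>r\<bar> / fact n * \<bar>s\<bar> ^ n * (\<bar>s\<bar> / (real n + 1))
      \<le> \<bar>r\<bar> / fact n * \<bar>s\<bar> ^ n * (1 / 2 * \<bar>\<nu> + real n + 1\<bar>)"
    by (intro mult_left_mono) auto
  moreover have "norm (rGamma (\<nu> + real n + 1) / fact n * s ^ n)
      = \<bar>r\<bar> / fact n * \<bar>s\<bar> ^ n * \<bar>\<nu> + real n + 1\<bar>"
  proof -
    have "rGamma (\<nu> + real n + 1) = (\<nu> + real n + 1) * r"
      using rGamma_plus1[of "\<nu> + real n + 1"] by (simp add: r_def add.assoc)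
    then show ?thesis
      by (simp only: real_norm_def abs_mult abs_divide power_abs) simp
  qed
  moreover have "\<nu> + real (Suc n) + 1 = \<nu> + real n + 2" by simp
  then have "norm (rGamma (\<nu> + real (Suc n) + 1) / fact (Suc n) * s ^ Suc n)
      = \<bar>r\<bar> / fact n * \<bar>s\<bar> ^ n * (\<bar>s\<bar> / (real n + 1))"
    unfolding r_def by (simp only:) (simp add: abs_mult power_abs mult_ac add_ac)
  ultimately show "norm (rGamma (\<nu> + real (Suc n) + 1) / fact (Suc n) * s ^ Suc n)
      \<le> 1 / 2 * norm (rGamma (\<nu> + real n + 1) / fact n * s ^ n)"
    by simp
qed simp

lemma diffs_rgamma:
  "diffs (\<lambda>n. rGamma (\<nu> + real n + 1) / fact n) = (\<lambda>n. rGamma (\<nu> + 1 + real n + 1) / fact n)"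
proof
  fix n
  have "1 + real n \<noteq> 0" by linarith
  then show "diffs (\<lambda>n. rGamma (\<nu> + real n + 1) / fact n) n = rGamma (\<nu> + 1 + real n + 1) / fact n"
    by (simp add: diffs_def add_ac)
qed

lemma has_real_derivative_rgamma_series:
  "(rgamma_series \<nu> has_real_derivative rgamma_series (\<nu> + 1) s) (at s)"
  using termdiffs_strong_converges_everywhere[OF summable_rgamma_series[of \<nu>], of s]
  unfolding diffs_rgamma rgamma_series_def .

text \<open>The product \<open>s * rgamma_series (\<nu> + 1) s\<close> is the Euler operator s d/ds
  applied to the series, which multiplies the n-th coefficient by n. The resulting factor
  \<open>\<nu> + real n\<close> is absorbed by the functional equation of
  \<open>rGamma\<close>.\<close>

lemma rgamma_series_recurrence:
  "rgamma_series (\<nu> - 1) s = \<nu> * rgamma_series \<nu> s + s * rgamma_series (\<nu> + 1) s"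
proof -
  let ?c = "\<lambda>n. rGamma (\<nu> + real n + 1) / fact n"
  have "(\<lambda>n. real n * ?c n * s ^ (n - Suc 0)) sums (\<Sum>n. diffs ?c n * s ^ n)"
    by (rule diffs_equiv) (simp only: diffs_rgamma summable_rgamma_series)
  then have "(\<lambda>n. real n * ?c n * s ^ (n - Suc 0)) sums rgamma_series (\<nu> + 1) s"
    by (simp only: diffs_rgamma rgamma_series_def)
  from sums_mult[OF this, of s] have "(\<lambda>n. real n * ?c n * s ^ n) sums (s * rgamma_series (\<nu> + 1) s)"
  proof (rule sums_cong[THEN iffD1, rotated])
    show "s * (real n * ?c n * s ^ (n - Suc 0)) = real n * ?c n * s ^ n" for n
      by (cases n) auto
  qed
  moreover have "(\<lambda>n. \<nu> * (?c n * s ^ n)) sums (\<nu> * rgamma_series \<nu> s)"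
    unfolding rgamma_series_def by (intro sums_mult summable_sums summable_rgamma_series)
  ultimately have *: "(\<lambda>n. \<nu> * (?c n * s ^ n) + real n * ?c n * s ^ n) sums
     (\<nu> * rgamma_series \<nu> s + s * rgamma_series (\<nu> + 1) s)"
    by (intro sums_add)
  have "(\<lambda>n. rGamma (\<nu> - 1 + real n + 1) / fact n * s ^ n) sums
     (\<nu> * rgamma_series \<nu> s + s * rgamma_series (\<nu> + 1) s)"
  proof (rule sums_cong[THEN iffD1, OF _ *])
    fix n
    have "rGamma (\<nu> - 1 + real n + 1) = (\<nu> + real n) * rGamma (\<nu> + real n + 1)"
      using rGamma_plus1[of "\<nu> + real n"] by simp
    then show "\<nu> * (?c n * s ^ n) + real n * ?c n * s ^ n = rGamma (\<nu> - 1 + real n + 1) / fact n * s ^ n"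
      by (simp add: field_simps)
  qed
  then show ?thesis
    unfolding rgamma_series_def by (simp add: sums_iff)
qed

text \<open>Plain differentiation raises the order; with the power in front it lowers it, since the
  product rule produces exactly the right-hand side of the recurrence. Both parts of
  \<open>bessel_series\<close> can thus be shifted consistently.\<close>

lemma has_real_derivative_powr_rgamma_series:
  assumes "s > 0"
  shows "((\<lambda>s. s powr \<nu> * rgamma_series \<nu> s) has_real_derivative
           s powr (\<nu> - 1) * rgamma_series (\<nu> - 1) s) (at s)"
proof -
  have "s powr \<nu> = s * s powr (\<nu> - 1)"
    using assms by (simp add: powr_diff)
  moreover have "((\<lambda>s. s powr \<nu> * rgamma_series \<nu> s) has_real_derivative
      \<nu> * s powr (\<nu> - 1) * rgamma_series \<nu> s + s powr \<nu> * rgamma_series (\<nu> + 1) s) (at s)"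
    using assms
    by (auto intro!: derivative_eq_intros has_real_derivative_powr has_real_derivative_rgamma_series)
  ultimately show ?thesis
    by (simp add: rgamma_series_recurrence[of \<nu>] algebra_simps)
qed

lemma bessel_I_eq_rgamma_series: "bessel_I \<theta> x = (x / 2) powr \<theta> * rgamma_series \<theta> ((x / 2)\<^sup>2)"
  unfolding bessel_I_def rgamma_series_def power_mult
  by (simp only: rGamma_inverse_Gamma divide_inverse inverse_mult_distrib mult_ac)

text \<open>For non-integer \<open>\<nu>\<close> and \<open>s > 0\<close> this is
  \<open>2 * s powr (\<nu> / 2)\<close> times K of order \<open>\<nu>\<close> at
  \<open>2 * sqrt s\<close>. At integers the sine vanishes, and division by zero makes the value 0
  instead of the limit.\<close>

definition bessel_series :: "real \<Rightarrow> real \<Rightarrow> real" where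
  "bessel_series \<nu> s = pi / sin (pi * \<nu>) * (rgamma_series (- \<nu>) s - s powr \<nu> * rgamma_series \<nu> s)"

lemma bessel_series_symm:
  assumes "s > 0"
  shows "bessel_series \<nu> s = s powr \<nu> * bessel_series (- \<nu>) s"
proof -
  have "s powr \<nu> * s powr (- \<nu>) = 1"
    using assms by (simp add: powr_minus)
  then have "s powr \<nu> * (rgamma_series \<nu> s - s powr (- \<nu>) * rgamma_series (- \<nu>) s)
      = s powr \<nu> * rgamma_series \<nu> s - rgamma_series (- \<nu>) s"
    by (simp add: right_diff_distrib flip: mult.assoc)
  then show ?thesis
    by (simp add: bessel_series_def algebra_simps)
qed

lemma has_real_derivative_bessel_series:
  assumes "s > 0"
  shows "(bessel_series \<nu> has_real_derivative - bessel_series (\<nu> - 1) s) (at s)"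
proof -
  have "((\<lambda>s. pi / sin (pi * \<nu>) * (rgamma_series (- \<nu>) s - s powr \<nu> * rgamma_series \<nu> s))
     has_real_derivative pi / sin (pi * \<nu>) *
       (rgamma_series (- \<nu> + 1) s - s powr (\<nu> - 1) * rgamma_series (\<nu> - 1) s)) (at s)"
    by (intro DERIV_cmult DERIV_diff has_real_derivative_rgamma_series
        has_real_derivative_powr_rgamma_series assms)
  \<comment> \<open>The sign change of the sine under a shift by pi supplies the minus sign in the
    derivative.\<close>
  moreover have "sin (pi * (\<nu> - 1)) = - sin (pi * \<nu>)"
    by (simp add: right_diff_distrib)
  ultimately show ?thesis
    by (simp add: bessel_series_def [abs_def])
qed

lemma Gamma_reflection_real:
  fixes x :: real
  assumes "x \<notin> \<int>"
  shows "Gamma x * Gamma (1 - x) = pi / sin (pi * x)"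
proof -
  have "complex_of_real (Gamma x * Gamma (1 - x)) = complex_of_real (pi / sin (pi * x))"
    using Gamma_reflection_complex[of "complex_of_real x"]
    by (simp flip: Gamma_complex_of_real sin_of_real)
  then show ?thesis
    by (simp only: of_real_eq_iff)
qed

text \<open>The term with \<open>s powr \<nu>\<close> dies at the origin and the other series has
  constant term \<open>rGamma (1 - \<nu>)\<close>; the reflection formula turns the product with the
  prefactor into \<open>Gamma \<nu>\<close>.\<close>

lemma tendsto_bessel_series_0:
  assumes "\<nu> > 0" "\<nu> \<notin> \<int>"
  shows "(bessel_series \<nu> \<longlongrightarrow> Gamma \<nu>) (at_right 0)"
proof -
  have cont: "(rgamma_series a \<longlongrightarrow> rgamma_series a 0) (at_right 0)" for a
    using DERIV_isCont[OF has_real_derivative_rgamma_series[of a 0]]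
    by (simp add: isCont_def filterlim_at_split)
  have "((\<lambda>s. s powr \<nu>) \<longlongrightarrow> 0) (at_right 0)"
    using assms by (intro tendsto_zero_powrI[where b = \<nu>] tendsto_intros)
      (auto intro: eventually_mono[OF eventually_at_right_less])
  then have "(bessel_series \<nu> \<longlongrightarrow> pi / sin (pi * \<nu>) *
      (rgamma_series (- \<nu>) 0 - 0 * rgamma_series \<nu> 0)) (at_right 0)"
    unfolding bessel_series_def [abs_def] by (intro tendsto_intros cont)
  moreover have "rgamma_series (- \<nu>) 0 = rGamma (1 - \<nu>)"
    unfolding rgamma_series_def powser_zero by (simp add: add.commute)
  moreover have "Gamma (1 - \<nu>) \<noteq> 0"
    using assms by (auto simp: Gamma_eq_zero_iff elim!: nonpos_Ints_cases)
      (metis Ints_1 Ints_diff Ints_of_int diff_diff_eq2 add.commute add_diff_cancel_left')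
  moreover from this have "Gamma \<nu> = pi / sin (pi * \<nu>) / Gamma (1 - \<nu>)"
    using Gamma_reflection_real[OF assms(2)] by (metis nonzero_mult_div_cancel_right)
  ultimately show ?thesis
    by (simp add: rGamma_inverse_Gamma divide_inverse)
qed

section \<open>The integral representation of \<open>K\<close>\<close>

text \<open>Equal to \<open>2 s\<^bsup>\<nu>/2\<^esup> K\<^sub>\<nu>(2 \<surd>s)\<close>.\<close>

definition macdonald :: "real \<Rightarrow> real \<Rightarrow> real" where
  "macdonald \<nu> s = (LINT t:{0<..}|lborel. exp (- s / t - t) * t powr (\<nu> - 1))"

lemma has_bochner_integral_Gamma:
  fixes \<nu> :: real
  assumes "\<nu> > 0"
  shows "has_bochner_integral lborel (\<lambda>t. indicator {0<..} t *\<^sub>R (exp (- t) * t powr (\<nu> - 1))) (Gamma \<nu>)"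
proof (rule has_bochner_integral_nn_integral)
  have "indicator {0<..} t *\<^sub>R (exp (- t) * t powr (\<nu> - 1))
      = indicator {0..} t * t powr (\<nu> - 1) / exp t" for t :: real
    by (cases "t = 0") (auto simp: indicator_def exp_minus field_simps)
  then show "(\<integral>\<^sup>+ t. ennreal (indicator {0<..} t *\<^sub>R (exp (- t) * t powr (\<nu> - 1))) \<partial>lborel) = ennreal (Gamma \<nu>)"
    by (simp only: Gamma_conv_nn_integral_real[OF assms])
qed (use assms Gamma_real_pos[of \<nu>] in auto)

lemma macdonald_0: "(\<nu> :: real) > 0 \<Longrightarrow> macdonald \<nu> 0 = Gamma \<nu>"
  using has_bochner_integral_Gamma[of \<nu>]
  by (simp add: macdonald_def set_lebesgue_integral_def has_bochner_integral_iff)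

lemma set_integrable_Gamma:
  fixes \<nu> :: real
  shows "\<nu> > 0 \<Longrightarrow> set_integrable lborel {0<..} (\<lambda>t. exp (- t) * t powr (\<nu> - 1))"
  using has_bochner_integral_Gamma[of \<nu>] by (simp add: set_integrable_def has_bochner_integral_iff)

text \<open>For positive \<open>s\<close> the factor \<open>exp (- s / t)\<close> vanishes at the
  origin faster than any power of \<open>t\<close>, so the integrand is dominated by a gamma
  integrand whose order has been raised to a positive value.\<close>

lemma set_integrable_macdonald:
  fixes \<nu> s :: real
  assumes "s > 0 \<or> s = 0 \<and> \<nu> > 0"
  shows "set_integrable lborel {0<..} (\<lambda>t. exp (- s / t - t) * t powr (\<nu> - 1))"
proof (cases "s = 0")
  case True
  then show ?thesis
    using assms set_integrable_Gamma[of \<nu>] by (simp add: True)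
next
  case False
  with assms have s: "s > 0" by simp
  define k where "k = nat \<lceil>\<bar>\<nu>\<bar> + 1\<rceil>"
  have k: "\<nu> + real k > 0"
    unfolding k_def by linarith
  have k0: "k > 0"
    unfolding k_def by linarith
  show ?thesis
  proof (rule set_integrable_bound[OF set_integrable_mult_right[OF set_integrable_Gamma[OF k], of "real k ^ k / s ^ k"]])
    have "exp (- s / t - t) * t powr (\<nu> - 1) \<le> real k ^ k / s ^ k * (exp (- t) * t powr (\<nu> + k - 1))"
      if t: "t > 0" for t
    proof -
      \<comment> \<open>The inequality between \<open>(1 + x / k) ^ k\<close> and
        \<open>exp x\<close> at \<open>x = s / t\<close> gives the explicit bound
        \<open>(k * t / s) ^ k\<close> for \<open>exp (- s / t)\<close>.\<close>
      have "(s / t / k) ^ k \<le> (1 + s / t / k) ^ k"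
        using s t by (intro power_mono) auto
      also have "\<dots> \<le> exp (s / t)"
        using s t k0 order_trans[of "- real k" 0 "s / t"]
        by (intro exp_ge_one_plus_x_over_n_power_n) auto
      finally have "(s / t / k) ^ k \<le> exp (s / t)" .
      then have "exp (- (s / t)) \<le> real k ^ k / s ^ k * t ^ k"
        using s t k0 by (simp add: exp_minus power_divide field_simps)
      then have "exp (- (s / t)) * (exp (- t) * t powr (\<nu> - 1))
          \<le> real k ^ k / s ^ k * t ^ k * (exp (- t) * t powr (\<nu> - 1))"
        by (rule mult_right_mono) simp
      moreover have "t powr (\<nu> + k - 1) = t ^ k * t powr (\<nu> - 1)"
        using t by (simp add: powr_add[symmetric] powr_realpow[symmetric] algebra_simps)
      ultimately show ?thesis
        by (simp add: exp_diff exp_minus field_simps)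
    qed
    then show "AE t in lborel. t \<in> {0<..} \<longrightarrow> norm (exp (- s / t - t) * t powr (\<nu> - 1))
        \<le> norm (real k ^ k / s ^ k * (exp (- t) * t powr (\<nu> + k - 1)))"
      using s by (intro AE_I2) (auto simp: abs_mult)
  qed (simp add: set_borel_measurable_def)
qed

section \<open>Regularity, symmetry and boundary value of the integral\<close>

lemma macdonald_nonneg: "macdonald \<nu> s \<ge> 0"
  unfolding macdonald_def set_lebesgue_integral_def by (intro Bochner_Integration.integral_nonneg) auto

text \<open>Convexity in \<open>s\<close>, which yields continuity and the derivative without dominated convergence.\<close>

lemma macdonald_tangent:
  assumes "s > 0" "s' > 0"
  shows "macdonald \<nu> s' - macdonald \<nu> s \<ge> - (s' - s) * macdonald (\<nu> - 1) s"
proof -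
  note int = set_integrable_macdonald[OF disjI1]
  have "(LINT t:{0<..}|lborel. - (s' - s) * (exp (- s / t - t) * t powr (\<nu> - 1 - 1)))
    \<le> (LINT t:{0<..}|lborel. exp (- s' / t - t) * t powr (\<nu> - 1) - exp (- s / t - t) * t powr (\<nu> - 1))"
  proof (rule set_integral_mono)
    fix t :: real assume "t \<in> {0<..}"
    then have t: "t > 0" by simp
    define E P where "E = exp (- s / t - t)" and "P = t powr (\<nu> - 1 - 1)"
    \<comment> \<open>The tangent line of exp at 0 gives the tangent inequality of the integrand in
      \<open>s\<close>; dividing by \<open>t\<close> is what lowers the order to
      \<open>\<nu> - 1\<close>.\<close>
    have "1 + (s - s') / t \<le> exp ((s - s') / t)"
      by (rule exp_ge_add_one_self)
    then have "t + (s - s') \<le> t * exp ((s - s') / t)"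
      using t by (simp add: field_simps)
    then have "(t + (s - s')) * (E * P) \<le> t * exp ((s - s') / t) * (E * P)"
      by (rule mult_right_mono) (simp add: E_def P_def)
    moreover have "exp (- s' / t - t) = exp ((s - s') / t) * E"
      by (simp add: E_def exp_add[symmetric] diff_divide_distrib)
    moreover have "t powr (\<nu> - 1) = t * P"
      using t powr_mult_base[of t "\<nu> - 1 - 1"] by (simp add: P_def)
    ultimately show "- (s' - s) * (exp (- s / t - t) * t powr (\<nu> - 1 - 1))
       \<le> exp (- s' / t - t) * t powr (\<nu> - 1) - exp (- s / t - t) * t powr (\<nu> - 1)"
      unfolding E_def[symmetric] P_def[symmetric] by (simp only:) (simp add: algebra_simps)
  qed (intro set_integrable_mult_right set_integral_diff int assms)+
  also have "\<dots> = macdonald \<nu> s' - macdonald \<nu> s"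
    unfolding macdonald_def by (intro set_integral_diff int assms)
  finally show ?thesis
    by (simp add: macdonald_def)
qed

text \<open>The tangent inequalities at both points bound the increment from both sides. Since the
  slopes are monotone in the argument, their value at \<open>s / 2\<close> is a Lipschitz constant
  on a neighbourhood of \<open>s\<close>.\<close>

lemma isCont_macdonald:
  assumes "s > 0"
  shows "isCont (macdonald \<nu>) s"
proof -
  have "\<forall>\<^sub>F s' in at s. dist (macdonald \<nu> s') (macdonald \<nu> s)
      \<le> dist s' s * macdonald (\<nu> - 1) (s / 2)"
  proof -
    have anti: "macdonald (\<nu> - 1) x \<le> macdonald (\<nu> - 1) y" if "0 < y" "y \<le> x" for x y
      using macdonald_tangent[of x y "\<nu> - 1"] mult_nonneg_nonneg[OF _ macdonald_nonneg[of "\<nu> - 1 - 1" x], of "x - y"] that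
      by simp
    have "\<forall>\<^sub>F s' in nhds s. s' > s / 2"
      using assms by (intro order_tendstoD(1)[OF filterlim_ident]) simp
    then show ?thesis
      unfolding eventually_at_filter
    proof eventually_elim
      case (elim s')
      have "macdonald \<nu> s' - macdonald \<nu> s \<ge> - (s' - s) * macdonald (\<nu> - 1) s"
        "macdonald \<nu> s - macdonald \<nu> s' \<ge> - (s - s') * macdonald (\<nu> - 1) s'"
        using elim assms by (intro macdonald_tangent; simp)+
      moreover have "\<bar>(s' - s) * macdonald (\<nu> - 1) s\<bar> \<le> \<bar>s' - s\<bar> * macdonald (\<nu> - 1) (s / 2)"
        "\<bar>(s' - s) * macdonald (\<nu> - 1) s'\<bar> \<le> \<bar>s' - s\<bar> * macdonald (\<nu> - 1) (s / 2)"
        using elim assms macdonald_nonneg[of "\<nu> - 1"]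
        by (auto simp: abs_mult intro!: mult_left_mono anti)
      ultimately show ?case
        by (simp add: dist_real_def abs_le_iff algebra_simps)
    qed
  qed
  moreover have "((\<lambda>s'. dist s' s * macdonald (\<nu> - 1) (s / 2)) \<longlongrightarrow> 0) (at s)"
    by (auto intro!: tendsto_eq_intros)
  ultimately show ?thesis
    unfolding isCont_def tendsto_dist_iff[of "macdonald \<nu>"]
    by (rule tendsto_sandwich[OF _ _ tendsto_const, rotated -2]) auto
qed

text \<open>The two tangent inequalities squeeze the difference quotient between the candidate
  slopes at \<open>s\<close> and at \<open>s'\<close>; continuity at order \<open>\<nu> - 1\<close>
  makes these slopes merge.\<close>

lemma has_real_derivative_macdonald:
  assumes "s > 0"
  shows "(macdonald \<nu> has_real_derivative - macdonald (\<nu> - 1) s) (at s)"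
proof -
  let ?q = "\<lambda>s'. (macdonald \<nu> s' - macdonald \<nu> s) / (s' - s)"
  have "\<forall>\<^sub>F s' in at s. dist (?q s') (- macdonald (\<nu> - 1) s)
      \<le> dist (macdonald (\<nu> - 1) s') (macdonald (\<nu> - 1) s)"
  proof -
    have "\<forall>\<^sub>F s' in nhds s. s' > 0"
      using assms by (intro order_tendstoD(1)[OF filterlim_ident]) simp
    then show ?thesis
      unfolding eventually_at_filter
    proof eventually_elim
      case (elim s')
      let ?m = "macdonald (\<nu> - 1) s" and ?m' = "macdonald (\<nu> - 1) s'"
      have 1: "macdonald \<nu> s' - macdonald \<nu> s \<ge> - (s' - s) * ?m"
        "macdonald \<nu> s' - macdonald \<nu> s \<le> - (s' - s) * ?m'"
        using elim assms macdonald_tangent[of s s' \<nu>] macdonald_tangent[of s' s \<nu>]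
        by (simp_all add: algebra_simps)
      show ?case
      proof (cases s' s rule: linorder_cases)
        case less
        then have "?q s' \<le> - ?m" "?q s' \<ge> - ?m'"
          using 1 by (simp_all add: field_simps)
        then show ?thesis by (simp add: dist_real_def)
      next
        case greater
        then have "?q s' \<ge> - ?m" "?q s' \<le> - ?m'"
          using 1 by (simp_all add: field_simps)
        then show ?thesis by (simp add: dist_real_def)
      qed simp
    qed
  qed
  moreover have "((\<lambda>s'. dist (macdonald (\<nu> - 1) s') (macdonald (\<nu> - 1) s)) \<longlongrightarrow> 0) (at s)"
    using isCont_macdonald[OF assms, of "\<nu> - 1"] by (simp add: isCont_def flip: tendsto_dist_iff)
  ultimately show ?thesis
    unfolding has_field_derivative_iff tendsto_dist_iff[of ?q]
    by (rule tendsto_sandwich[OF _ _ tendsto_const, rotated -2]) auto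
qed

text \<open>The substitution of \<open>s / t\<close> for \<open>t\<close> exchanges the two terms of
  the exponent and reverses the sign of the order.\<close>

lemma macdonald_symm:
  assumes "s > 0"
  shows "macdonald \<nu> s = s powr \<nu> * macdonald (- \<nu>) s"
proof -
  let ?f = "\<lambda>\<nu> t::real. exp (- s / t - t) * t powr (\<nu> - 1)"
  note int = set_integrable_macdonald[OF disjI1[OF assms]]
  \<comment> \<open>The change-of-variables theorem speaks of the completed Lebesgue measure, hence
    the passage from \<open>lborel\<close> through the completion.\<close>
  have abs: "?f \<nu> absolutely_integrable_on {0<..}" for \<nu>
    using int[of \<nu>] unfolding set_integrable_def by (subst integrable_completion) auto
  have eq: "macdonald \<nu> s = integral {0<..} (?f \<nu>)" for \<nu>
    unfolding macdonald_def by (rule set_borel_integral_eq_integral[OF int])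
  have img: "(\<lambda>t. s / t) ` {0<..} = {0<..}"
  proof (intro antisym subsetI)
    show "x \<in> (\<lambda>t. s / t) ` {0<..}" if "x \<in> {0<..}" for x
      using that assms by (intro image_eqI[of _ _ "s / x"]) auto
  qed (use assms in auto)
  have "integral {0<..} (\<lambda>t. \<bar>- s / t\<^sup>2\<bar> * ?f \<nu> (s / t)) = integral {0<..} (?f \<nu>)"
  proof -
    have "(\<lambda>t. \<bar>- s / t\<^sup>2\<bar> * ?f \<nu> (s / t)) absolutely_integrable_on {0<..} \<and>
        integral {0<..} (\<lambda>t. \<bar>- s / t\<^sup>2\<bar> * ?f \<nu> (s / t)) = integral {0<..} (?f \<nu>) \<longleftrightarrow>
      ?f \<nu> absolutely_integrable_on (\<lambda>t. s / t) ` {0<..} \<and>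
        integral ((\<lambda>t. s / t) ` {0<..}) (?f \<nu>) = integral {0<..} (?f \<nu>)"
    proof (rule has_absolute_integral_change_of_variables_1')
      show "((\<lambda>t. s / t) has_real_derivative - s / t\<^sup>2) (at t within {0<..})" if "t \<in> {0<..}" for t
        using that by (auto intro!: derivative_eq_intros simp: power2_eq_square)
      show "inj_on (\<lambda>t. s / t) {0<..}"
        using assms by (auto simp: inj_on_def field_simps)
    qed auto
    then show ?thesis
      using abs img by simp
  qed
  moreover have "\<bar>- s / t\<^sup>2\<bar> * ?f \<nu> (s / t) = s powr \<nu> * ?f (- \<nu>) t" if "t \<in> {0<..}" for t
  proof -
    have t: "t > 0" using that by simp
    have "\<bar>- s / t\<^sup>2\<bar> * ?f \<nu> (s / t) = exp (- s / t - t) * (s / t\<^sup>2 * (s / t) powr (\<nu> - 1))"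
      using assms t by (simp add: algebra_simps)
    also have "s / t\<^sup>2 * (s / t) powr (\<nu> - 1) = s powr \<nu> * t powr (- \<nu> - 1)"
      using assms t by (simp add: powr_divide powr_diff powr_minus field_simps power2_eq_square)
    finally show ?thesis by simp
  qed
  then have "integral {0<..} (\<lambda>t. \<bar>- s / t\<^sup>2\<bar> * ?f \<nu> (s / t)) = integral {0<..} (\<lambda>t. s powr \<nu> * ?f (- \<nu>) t)"
    by (rule Henstock_Kurzweil_Integration.integral_cong)
  ultimately show ?thesis
    unfolding eq by simp
qed

text \<open>The bound \<open>1 - exp (- x) \<le> x powr (\<nu> / 2)\<close> for positive
  \<open>x\<close> gives an explicit rate. Spending only half of the available exponent leaves
  \<open>t powr (\<nu> / 2 - 1)\<close>, still integrable at the origin.\<close>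

lemma tendsto_macdonald_0:
  assumes "0 < \<nu>" "\<nu> < 1"
  shows "(macdonald \<nu> \<longlongrightarrow> Gamma \<nu>) (at_right 0)"
proof -
  have "\<forall>\<^sub>F s in at_right 0. dist (macdonald \<nu> s) (Gamma \<nu>) \<le> s powr (\<nu> / 2) * Gamma (\<nu> / 2)"
    using eventually_at_right_less
  proof eventually_elim
    case (elim s)
    note int0 = set_integrable_macdonald[of 0 \<nu>] and ints = set_integrable_macdonald[of s \<nu>]
      and int2 = set_integrable_macdonald[of 0 "\<nu> / 2"]
    have bd: "0 \<le> exp (- 0 / t - t) * t powr (\<nu> - 1) - exp (- s / t - t) * t powr (\<nu> - 1) \<and>
       exp (- 0 / t - t) * t powr (\<nu> - 1) - exp (- s / t - t) * t powr (\<nu> - 1)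
       \<le> s powr (\<nu> / 2) * (exp (- 0 / t - t) * t powr (\<nu> / 2 - 1))" if t: "t > 0" for t
    proof -
      have "1 - exp (- (s / t)) \<le> (s / t) powr (\<nu> / 2)"
      proof (cases "s / t \<le> 1")
        case True
        have "1 - exp (- (s / t)) \<le> s / t"
          using exp_ge_add_one_self[of "- (s / t)"] by linarith
        also have "\<dots> = (s / t) powr 1"
          using elim t by simp
        also have "\<dots> \<le> (s / t) powr (\<nu> / 2)"
          using assms elim t True by (intro powr_mono') auto
        finally show ?thesis .
      next
        case False
        then have "1 \<le> (s / t) powr (\<nu> / 2)"
          using assms by (intro ge_one_powr_ge_zero) auto
        then show ?thesis by (smt (verit) exp_gt_zero)
      qed
      then have "(1 - exp (- (s / t))) * (exp (- t) * t powr (\<nu> - 1))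
          \<le> (s / t) powr (\<nu> / 2) * (exp (- t) * t powr (\<nu> - 1))"
        by (rule mult_right_mono) simp
      moreover have "(s / t) powr (\<nu> / 2) * t powr (\<nu> - 1) = s powr (\<nu> / 2) * t powr (\<nu> / 2 - 1)"
      proof -
        have "t powr (\<nu> - 1) = t powr (\<nu> / 2) * t powr (\<nu> / 2 - 1)"
          by (simp add: powr_add[symmetric])
        then show ?thesis using elim t by (simp add: powr_divide)
      qed
      moreover have "exp (- s / t - t) = exp (- (s / t)) * exp (- t)"
        by (simp add: exp_add[symmetric])
      moreover have "exp (- (s / t)) \<le> 1"
        using elim t by simp
      ultimately show ?thesis
        by (simp add: algebra_simps mult_left_le_one_le)
    qed
    have "Gamma \<nu> - macdonald \<nu> s = (LINT t:{0<..}|lborel. exp (- 0 / t - t) * t powr (\<nu> - 1) -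
        exp (- s / t - t) * t powr (\<nu> - 1))"
      using assms elim unfolding macdonald_0[OF assms(1), symmetric] macdonald_def
      by (intro set_integral_diff(2)[symmetric] int0 ints) auto
    moreover have "\<dots> \<ge> 0"
      using bd unfolding set_lebesgue_integral_def
      by (intro Bochner_Integration.integral_nonneg) (auto simp: indicator_def)
    moreover have "(LINT t:{0<..}|lborel. exp (- 0 / t - t) * t powr (\<nu> - 1) -
        exp (- s / t - t) * t powr (\<nu> - 1)) \<le>
      (LINT t:{0<..}|lborel. s powr (\<nu> / 2) * (exp (- 0 / t - t) * t powr (\<nu> / 2 - 1)))"
      using bd assms elim
      by (intro set_integral_mono set_integrable_mult_right set_integral_diff(1) int0 ints int2) auto
    moreover have "\<dots> = s powr (\<nu> / 2) * Gamma (\<nu> / 2)"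
      using assms macdonald_0[of "\<nu> / 2"] by (simp add: macdonald_def)
    ultimately show ?case
      unfolding dist_real_def by linarith
  qed
  moreover have "((\<lambda>s. s powr (\<nu> / 2) * Gamma (\<nu> / 2)) \<longlongrightarrow> 0) (at_right 0)"
  proof -
    have "((\<lambda>s. s powr (\<nu> / 2)) \<longlongrightarrow> 0) (at_right 0)"
      using assms by (intro tendsto_zero_powrI[where b = "\<nu> / 2"] tendsto_intros)
        (auto intro: eventually_mono[OF eventually_at_right_less])
    from tendsto_mult_right[OF this, of "Gamma (\<nu> / 2)"] show ?thesis by simp
  qed
  ultimately show ?thesis
    unfolding tendsto_dist_iff[of "macdonald \<nu>"]
    by (rule tendsto_sandwich[OF _ _ tendsto_const, rotated -2]) auto
qed

text \<open>As a function of the order the integrand is an exponential with rate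
  \<open>ln t\<close>, hence convex. Convexity passes to the integral, and a finite convex function
  on the whole line is continuous.\<close>

lemma isCont_macdonald_index:
  assumes "s > 0"
  shows "isCont (\<lambda>\<nu>. macdonald \<nu> s) \<nu>"
proof -
  have "convex_on UNIV (\<lambda>\<nu>. macdonald \<nu> s)"
  proof (rule convex_onI)
    fix u a b :: real assume u: "0 < u" "u < 1"
    note int = set_integrable_macdonald[OF disjI1[OF assms]]
    have "macdonald ((1 - u) *\<^sub>R a + u *\<^sub>R b) s \<le>
      (LINT t:{0<..}|lborel. (1 - u) * (exp (- s / t - t) * t powr (a - 1)) + u * (exp (- s / t - t) * t powr (b - 1)))"
      unfolding macdonald_def
    proof (rule set_integral_mono)
      fix t :: real assume "t \<in> {0<..}"
      then have t: "t > 0" by simp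
      have "exp ((1 - u) *\<^sub>R ((a - 1) * ln t) + u *\<^sub>R ((b - 1) * ln t))
          \<le> (1 - u) * exp ((a - 1) * ln t) + u * exp ((b - 1) * ln t)"
        using u by (intro convex_onD[OF exp_convex]) auto
      moreover have "(1 - u) *\<^sub>R ((a - 1) * ln t) + u *\<^sub>R ((b - 1) * ln t)
          = ((1 - u) *\<^sub>R a + u *\<^sub>R b - 1) * ln t"
        by (simp add: algebra_simps)
      ultimately have "t powr ((1 - u) *\<^sub>R a + u *\<^sub>R b - 1) \<le> (1 - u) * t powr (a - 1) + u * t powr (b - 1)"
        using t by (simp add: powr_def)
      from mult_left_mono[OF this, of "exp (- s / t - t)"]
      show "exp (- s / t - t) * t powr ((1 - u) *\<^sub>R a + u *\<^sub>R b - 1) \<le>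
        (1 - u) * (exp (- s / t - t) * t powr (a - 1)) + u * (exp (- s / t - t) * t powr (b - 1))"
        by (simp add: algebra_simps)
    qed (intro set_integral_add set_integrable_mult_right int)+
    also have "\<dots> = (1 - u) * macdonald a s + u * macdonald b s"
      unfolding macdonald_def
      by (subst set_integral_add) (intro set_integrable_mult_right int | simp)+
    finally show "macdonald ((1 - u) *\<^sub>R a + u *\<^sub>R b) s \<le> (1 - u) * macdonald a s + u * macdonald b s" .
  qed simp
  from convex_on_continuous[OF open_UNIV this] show ?thesis
    by (simp add: continuous_on_eq_continuous_at)
qed

section \<open>Uniqueness for a first-order system singular at the origin\<close>

lemma nonneg_if_tendsto_0_deriv_nonneg:
  fixes h :: "real \<Rightarrow> real"
  assumes "(h \<longlongrightarrow> 0) (at_right 0)"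
    and "\<And>x. 0 < x \<Longrightarrow> x \<le> S \<Longrightarrow> (h has_real_derivative h' x) (at x)"
    and "\<And>x. 0 < x \<Longrightarrow> x \<le> S \<Longrightarrow> h' x \<ge> 0"
    and "0 < x" "x \<le> S"
  shows "h x \<ge> 0"
proof (rule tendsto_upperbound[OF assms(1)])
  have "h y \<le> h x" if "0 < y" "y < x" for y
  proof (rule DERIV_nonneg_imp_nondecreasing[of y x h])
    show "\<exists>z. (h has_real_derivative z) (at u) \<and> 0 \<le> z" if "y \<le> u" "u \<le> x" for u
      using assms(2,3)[of u] assms(5) that \<open>0 < y\<close> by auto
  qed (use that in auto)
  then show "\<forall>\<^sub>F y in at_right 0. h y \<le> h x"
    using assms(4) by (auto simp: eventually_at_right[of 0 1])
qed simp

text \<open>The sum and the difference of \<open>g\<close> and \<open>f\<close> both start at 0 and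
  are nondecreasing. This replaces integrating the derivative bound from the singular
  endpoint.\<close>

lemma abs_le_if_tendsto_0_abs_deriv_le:
  fixes f g :: "real \<Rightarrow> real"
  assumes lim: "(f \<longlongrightarrow> 0) (at_right 0)" "(g \<longlongrightarrow> 0) (at_right 0)"
    and deriv: "\<And>x. 0 < x \<Longrightarrow> x \<le> S \<Longrightarrow> (f has_real_derivative f' x) (at x)"
      "\<And>x. 0 < x \<Longrightarrow> x \<le> S \<Longrightarrow> (g has_real_derivative g' x) (at x)"
    and le: "\<And>x. 0 < x \<Longrightarrow> x \<le> S \<Longrightarrow> \<bar>f' x\<bar> \<le> g' x"
    and x: "0 < x" "x \<le> S"
  shows "\<bar>f x\<bar> \<le> g x"
proof -
  have "((\<lambda>x. g x - f x) \<longlongrightarrow> 0) (at_right 0)" "((\<lambda>x. g x + f x) \<longlongrightarrow> 0) (at_right 0)"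
    using tendsto_diff[OF lim(2,1)] tendsto_add[OF lim(2,1)] by simp_all
  moreover have "g' x - f' x \<ge> 0" "g' x + f' x \<ge> 0" if "0 < x" "x \<le> S" for x
    using le[OF that] by linarith+
  ultimately have "g x - f x \<ge> 0" "g x + f x \<ge> 0"
    using nonneg_if_tendsto_0_deriv_nonneg[of "\<lambda>x. g x - f x" S "\<lambda>x. g' x - f' x" x]
      nonneg_if_tendsto_0_deriv_nonneg[of "\<lambda>x. g x + f x" S "\<lambda>x. g' x + f' x" x]
    by (simp_all add: DERIV_diff DERIV_add deriv x)
  then show ?thesis by linarith
qed

lemma bounded_if_tendsto_at_right_0:
  fixes f :: "real \<Rightarrow> real"
  assumes lim: "(f \<longlongrightarrow> 0) (at_right 0)" and cont: "\<And>s. s > 0 \<Longrightarrow> isCont f s"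
  obtains C where "C > 0" "\<And>s. 0 < s \<Longrightarrow> s \<le> S \<Longrightarrow> \<bar>f s\<bar> \<le> C"
proof -
  obtain d where d: "d > 0" "\<And>s. 0 < s \<Longrightarrow> s < d \<Longrightarrow> \<bar>f s\<bar> < 1"
    using tendstoD[OF lim, of 1] by (auto simp: eventually_at_right[of 0 1] dist_real_def)
  have "continuous_on {d..S} f"
    using d cont by (intro continuous_at_imp_continuous_on) auto
  then have "bounded (f ` {d..S})"
    by (intro compact_imp_bounded compact_continuous_image) auto
  then obtain B where B: "\<forall>s\<in>{d..S}. \<bar>f s\<bar> \<le> B"
    by (auto simp: bounded_iff)
  show ?thesis
  proof (rule that[of "max 1 B"])
    show "\<bar>f s\<bar> \<le> max 1 B" if "0 < s" "s \<le> S" for s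
      using that d(2)[of s] B[THEN bspec, of s] by (cases "s < d") auto
  qed simp
qed

text \<open>Picard iteration: a bound \<open>\<bar>f s\<bar> \<le> C\<close> on \<open>(0, S]\<close> improves to \<open>C s\<^sup>k / ((1 - \<nu>)\<^sup>k k!)\<close> for every \<open>k\<close>.\<close>

lemma coupled_system_eq_0:
  fixes f g :: "real \<Rightarrow> real"
  assumes \<nu>: "0 < \<nu>" "\<nu> < 1"
    and lim: "(f \<longlongrightarrow> 0) (at_right 0)" "(g \<longlongrightarrow> 0) (at_right 0)"
    and df: "\<And>s. s > 0 \<Longrightarrow> (f has_real_derivative - (s powr (\<nu> - 1) * g s)) (at s)"
    and dg: "\<And>s. s > 0 \<Longrightarrow> (g has_real_derivative - (s powr (- \<nu>) * f s)) (at s)"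
    and S: "S > 0"
  shows "f S = 0"
proof -
  obtain C where C: "C > 0" "\<And>s. 0 < s \<Longrightarrow> s \<le> S \<Longrightarrow> \<bar>f s\<bar> \<le> C"
    using bounded_if_tendsto_at_right_0[OF lim(1), of S] DERIV_isCont[OF df] by metis
  have bound: "\<bar>f s\<bar> \<le> C / ((1 - \<nu>) ^ k * fact k) * s ^ k" if "0 < s" "s \<le> S" for s k
    using that
  \<comment> \<open>Each round integrates twice: the bound on \<open>f\<close> yields one on
    \<open>g\<close> with power \<open>real k + 1 - \<nu>\<close>, and that one yields a bound on
    \<open>f\<close> with power \<open>real k + 1\<close>.\<close>
  proof (induction k arbitrary: s)
    case 0
    then show ?case using C by simp
  next
    case (Suc k)
    define D where "D = C / ((1 - \<nu>) ^ k * fact k)"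
    have D: "D > 0" using C \<nu> by (simp add: D_def)
    have p0: "((\<lambda>s. c * s powr e) \<longlongrightarrow> 0) (at_right 0)" if "e > 0" for c e :: real
    proof -
      have "((\<lambda>s. s powr e) \<longlongrightarrow> 0) (at_right 0)"
        using that by (intro tendsto_zero_powrI[where b = e] tendsto_intros)
          (auto intro: eventually_mono[OF eventually_at_right_less])
      from tendsto_mult_right[OF this, of c] show ?thesis by (simp add: mult.commute)
    qed
    have dp: "((\<lambda>s. c / e * s powr e) has_real_derivative c * x powr (e - 1)) (at x)"
      if "e > 0" "x > 0" for c e x :: real
      using DERIV_cmult[OF has_real_derivative_powr[OF that(2), of e], of "c / e"] that by simp
    have g: "\<bar>g s\<bar> \<le> D / (real k + 1 - \<nu>) * s powr (real k + 1 - \<nu>)" if "0 < s" "s \<le> S" for s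
    proof (rule abs_le_if_tendsto_0_abs_deriv_le[OF lim(2), where S = S and x = s
          and g = "\<lambda>s. D / (real k + 1 - \<nu>) * s powr (real k + 1 - \<nu>)"
          and f' = "\<lambda>x. - (x powr - \<nu> * f x)" and g' = "\<lambda>x. D * x powr (real k - \<nu>)"])
      show "((\<lambda>s. D / (real k + 1 - \<nu>) * s powr (real k + 1 - \<nu>)) \<longlongrightarrow> 0) (at_right 0)"
        using \<nu> by (intro p0) auto
      show "((\<lambda>s. D / (real k + 1 - \<nu>) * s powr (real k + 1 - \<nu>)) has_real_derivative D * x powr (real k - \<nu>)) (at x)"
        if "0 < x" for x
        using dp[of "real k + 1 - \<nu>" x D] \<nu> that by (simp add: algebra_simps)
      show "\<bar>- (x powr - \<nu> * f x)\<bar> \<le> D * x powr (real k - \<nu>)" if "0 < x" "x \<le> S" for x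
      proof -
        have "x powr - \<nu> * \<bar>f x\<bar> \<le> x powr - \<nu> * (D * x ^ k)"
          unfolding D_def using Suc.IH[OF that] by (intro mult_left_mono) auto
        also have "\<dots> = D * x powr (real k - \<nu>)"
          using that by (simp add: powr_diff powr_minus powr_realpow field_simps)
        finally show ?thesis by (simp add: abs_mult)
      qed
      show "(g has_real_derivative - (x powr - \<nu> * f x)) (at x)" if "0 < x" for x
        using that by (rule dg)
    qed (fact that)+
    have "\<bar>f s\<bar> \<le> D / (1 - \<nu>) / (real k + 1) * s powr (real k + 1)"
    proof (rule abs_le_if_tendsto_0_abs_deriv_le[OF lim(1), where S = S and x = s
          and g = "\<lambda>s. D / (1 - \<nu>) / (real k + 1) * s powr (real k + 1)"
          and f' = "\<lambda>x. - (x powr (\<nu> - 1) * g x)" and g' = "\<lambda>x. D / (1 - \<nu>) * x powr real k"])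
      show "((\<lambda>s. D / (1 - \<nu>) / (real k + 1) * s powr (real k + 1)) \<longlongrightarrow> 0) (at_right 0)"
        by (intro p0) auto
      show "((\<lambda>s. D / (1 - \<nu>) / (real k + 1) * s powr (real k + 1)) has_real_derivative D / (1 - \<nu>) * x powr real k) (at x)"
        if "0 < x" for x
        using dp[of "real k + 1" x "D / (1 - \<nu>)"] that by simp
      show "\<bar>- (x powr (\<nu> - 1) * g x)\<bar> \<le> D / (1 - \<nu>) * x powr real k" if "0 < x" "x \<le> S" for x
      proof -
        have "x powr (\<nu> - 1) * \<bar>g x\<bar> \<le> x powr (\<nu> - 1) * (D / (real k + 1 - \<nu>) * x powr (real k + 1 - \<nu>))"
          using g[OF that] by (intro mult_left_mono) auto
        also have "\<dots> = D / (real k + 1 - \<nu>) * x powr real k"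
          using that by (simp add: powr_add[symmetric])
        \<comment> \<open>Replacing the denominator by the smaller \<open>1 - \<nu>\<close>,
          independent of \<open>k\<close>, keeps the closed form of the constant: one geometric
          factor per round.\<close>
        also have "\<dots> \<le> D / (1 - \<nu>) * x powr real k"
          using D \<nu> by (intro mult_right_mono divide_left_mono) auto
        finally show ?thesis by (simp add: abs_mult)
      qed
      show "(f has_real_derivative - (x powr (\<nu> - 1) * g x)) (at x)" if "0 < x" for x
        using that by (rule df)
    qed (fact Suc.prems)+
    also have "s powr (real k + 1) = s ^ Suc k"
      using Suc.prems powr_realpow[of s "Suc k"] by (simp add: add.commute)
    also have "D / (1 - \<nu>) / (real k + 1) = C / ((1 - \<nu>) ^ Suc k * fact (Suc k))"
      by (simp add: D_def field_simps)
    finally show ?case .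
  qed
  \<comment> \<open>The bounds at \<open>S\<close> are terms of the exponential series at
    \<open>S / (1 - \<nu>)\<close>, so they tend to 0.\<close>
  have "(\<lambda>k. C * (inverse (fact k) *\<^sub>R (S / (1 - \<nu>)) ^ k)) \<longlonglongrightarrow> C * 0"
    by (intro tendsto_intros summable_LIMSEQ_zero summable_exp_generic)
  moreover have "\<bar>f S\<bar> \<le> C * (inverse (fact k) *\<^sub>R (S / (1 - \<nu>)) ^ k)" for k
    using bound[of S k] S by (simp add: power_divide field_simps)
  ultimately have "\<bar>f S\<bar> \<le> C * 0"
    by (intro LIMSEQ_le_const) auto
  then show ?thesis by simp
qed

lemma macdonald_eq_bessel_series_01:
  assumes "0 < \<nu>" "\<nu> < 1" "s > 0"
  shows "macdonald \<nu> s = bessel_series \<nu> s"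
proof -
  have notint: "\<nu> \<notin> \<int>" "1 - \<nu> \<notin> \<int>"
    using assms(1,2) by (auto elim!: Ints_cases) 
  have lim: "((\<lambda>s. macdonald \<mu> s - bessel_series \<mu> s) \<longlongrightarrow> 0) (at_right 0)"
    if "0 < \<mu>" "\<mu> < 1" "\<mu> \<notin> \<int>" for \<mu>
    using tendsto_diff[OF tendsto_macdonald_0 tendsto_bessel_series_0, of \<mu> \<mu>] that by simp
  \<comment> \<open>Differentiation leads to order \<open>\<mu> - 1\<close>, and the symmetry
    reflects it to \<open>1 - \<mu>\<close>, again in the unit interval when \<open>\<mu>\<close>
    is. This closes the system of two functions.\<close>
  have deriv: "((\<lambda>s. macdonald \<mu> s - bessel_series \<mu> s) has_real_derivative
      - (s powr (\<mu> - 1) * (macdonald (1 - \<mu>) s - bessel_series (1 - \<mu>) s))) (at s)" if "s > 0" for \<mu> s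
    using DERIV_diff[OF has_real_derivative_macdonald has_real_derivative_bessel_series, of s \<mu> \<mu>]
      macdonald_symm[of s "\<mu> - 1"] bessel_series_symm[of s "\<mu> - 1"] that
    by (simp add: algebra_simps)
  have "macdonald \<nu> s - bessel_series \<nu> s = 0"
  proof (rule coupled_system_eq_0[where f = "\<lambda>s. macdonald \<nu> s - bessel_series \<nu> s"
        and g = "\<lambda>s. macdonald (1 - \<nu>) s - bessel_series (1 - \<nu>) s"])
    show "((\<lambda>s. macdonald (1 - \<nu>) s - bessel_series (1 - \<nu>) s) has_real_derivative
      - (s powr - \<nu> * (macdonald \<nu> s - bessel_series \<nu> s))) (at s)" if "s > 0" for s
      using deriv[OF that, of "1 - \<nu>"] by simp
  qed (use assms notint in \<open>auto intro!: lim deriv\<close>)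
  then show ?thesis by simp
qed

text \<open>Differentiating an identity valid on the whole half-line lowers the order by one, which
  reaches every non-integer order below 1 from its fractional part; the symmetry covers the orders
  above 1.\<close>

theorem macdonald_eq_bessel_series:
  assumes "\<nu> \<notin> \<int>" "s > 0"
  shows "macdonald \<nu> s = bessel_series \<nu> s"
proof -
  have down: "macdonald (\<mu> - real n) s = bessel_series (\<mu> - real n) s"
    if "0 < \<mu>" "\<mu> < 1" "s > 0" for \<mu> s and n :: nat
    using that(3)
  proof (induction n arbitrary: s)
    case 0
    then show ?case using that macdonald_eq_bessel_series_01 by simp
  next
    case (Suc n)
    have "(bessel_series (\<mu> - real n) has_real_derivative - macdonald (\<mu> - real n - 1) s) (at s)"
      by (rule has_field_derivative_transform_within_open[OF has_real_derivative_macdonald, where S = "{0<..}"])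
        (use Suc in auto)
    from DERIV_unique[OF this has_real_derivative_bessel_series] Suc.prems
    show ?case by (simp add: algebra_simps)
  qed
  have neg: "macdonald \<mu> s = bessel_series \<mu> s" if "\<mu> \<notin> \<int>" "\<mu> < 1" for \<mu>
  proof -
    have frac: "frac \<mu> > 0" "frac \<mu> < 1"
      using that frac_ge_0[of \<mu>] frac_lt_1[of \<mu>] by (auto simp: less_le)
    define n where "n = nat (- \<lfloor>\<mu>\<rfloor>)"
    have "\<lfloor>\<mu>\<rfloor> \<le> 0"
      using that by linarith
    then have eq: "frac \<mu> - real n = \<mu>"
      by (simp add: frac_def n_def)
    show ?thesis
      using down[OF frac assms(2), of n] unfolding eq .
  qed
  show ?thesis
  proof (cases "\<nu> < 1")
    case False
    then have "macdonald (- \<nu>) s = bessel_series (- \<nu>) s"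
      using assms by (intro neg) auto
    then show ?thesis
      by (simp only: macdonald_symm[OF assms(2), of \<nu>] bessel_series_symm[OF assms(2), of \<nu>])
  qed (use assms neg in auto)
qed

text \<open>At an integer order K is a limit of values at nearby orders. The integral side is
  continuous in the order and agrees with these values off the integers, so it computes the
  limit.\<close>

theorem bessel_K_eq_macdonald:
  assumes "x > 0"
  shows "bessel_K \<theta> x = (x / 2) powr (- \<theta>) / 2 * macdonald \<theta> ((x / 2)\<^sup>2)"
proof -
  define K where "K = (\<lambda>t. pi / (2 * sin (t * pi)) * (bessel_I (- t) x - bessel_I t x))"
  define J where "J = (\<lambda>t. (x / 2) powr (- t) / 2 * macdonald t ((x / 2)\<^sup>2))"
  have KJ: "K t = J t" if "t \<notin> \<int>" for t
  proof -
    have "((x / 2)\<^sup>2) powr t = (x / 2) powr t * (x / 2) powr t"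
      unfolding power2_eq_square by (rule powr_mult)
    then have "(x / 2) powr t = (x / 2) powr (- t) * ((x / 2)\<^sup>2) powr t"
      using assms by (simp add: powr_minus)
    then have "bessel_I t x = (x / 2) powr (- t) * (((x / 2)\<^sup>2) powr t * rgamma_series t ((x / 2)\<^sup>2))"
      by (simp add: bessel_I_eq_rgamma_series)
    moreover have "bessel_I (- t) x = (x / 2) powr (- t) * rgamma_series (- t) ((x / 2)\<^sup>2)"
      by (simp add: bessel_I_eq_rgamma_series)
    moreover have "macdonald t ((x / 2)\<^sup>2) = bessel_series t ((x / 2)\<^sup>2)"
      using that assms by (intro macdonald_eq_bessel_series) auto
    ultimately show ?thesis
      by (simp only: K_def J_def bessel_series_def) (simp add: algebra_simps)
  qed
  have "bessel_K \<theta> x = (if \<theta> \<notin> \<int> then K \<theta> else Lim (at \<theta>) K)"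
    by (simp add: bessel_K_def K_def Let_def)
  also have "\<dots> = J \<theta>"
  proof (cases "\<theta> \<in> \<int>")
    case True
    have "isCont J \<theta>"
      unfolding J_def using assms by (intro continuous_intros isCont_macdonald_index) auto
    moreover have "\<forall>\<^sub>F t in at \<theta>. J t = K t"
    proof -
      \<comment> \<open>Distinct integers are at least 1 apart, so the punctured unit neighbourhood
        of an integer order contains only non-integer orders.\<close>
      have "t \<notin> \<int>" if "t \<noteq> \<theta>" "dist t \<theta> < 1" for t
      proof
        assume "t \<in> \<int>"
        with True obtain m n where "t = of_int m" "\<theta> = of_int n"
          by (auto elim!: Ints_cases)
        with that show False by (simp add: dist_real_def flip: of_int_diff of_int_abs)
      qed
      then show ?thesis
        using KJ by (auto simp: eventually_at intro!: exI[of _ 1])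
    qed
    ultimately have "(K \<longlongrightarrow> J \<theta>) (at \<theta>)"
      by (auto simp: isCont_def elim: Lim_transform_eventually)
    with True show ?thesis by (simp add: tendsto_Lim)
  qed (simp add: KJ)
  finally show ?thesis by (simp add: J_def)
qed

section \<open>Lebesgue measure on the complex plane\<close>

text \<open>Lebesgue measure is determined by its values on boxes, which identifies it with the
  image of the product measure. Both orders of integration are kept because the two kinds of shear
  act on different coordinates.\<close>

lemma nn_integral_lborel_complex:
  fixes f :: "complex \<Rightarrow> ennreal"
  assumes [measurable]: "f \<in> borel_measurable borel"
  shows "(\<integral>\<^sup>+z. f z \<partial>lborel) = (\<integral>\<^sup>+x. \<integral>\<^sup>+y. f (Complex x y) \<partial>lborel \<partial>lborel)"
    and "(\<integral>\<^sup>+z. f z \<partial>lborel) = (\<integral>\<^sup>+y. \<integral>\<^sup>+x. f (Complex x y) \<partial>lborel \<partial>lborel)"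
proof -
  have [measurable]: "(\<lambda>(x, y). Complex x y) \<in> borel \<Otimes>\<^sub>M borel \<rightarrow>\<^sub>M borel"
    unfolding borel_prod by (intro borel_measurable_continuous_onI) (auto simp: split_beta Complex_eq intro!: continuous_intros)
  have "lborel = distr (lborel \<Otimes>\<^sub>M lborel) borel (\<lambda>(x, y). Complex x y)"
  proof (rule lborel_eqI)
    fix l u :: complex assume lu: "\<And>b. b \<in> Basis \<Longrightarrow> l \<bullet> b \<le> u \<bullet> b"
    have le: "Re l \<le> Re u" "Im l \<le> Im u"
      using lu[of 1] lu[of \<i>] by (simp_all add: Basis_complex_def)
    have "(\<lambda>(x, y). Complex x y) -` box l u \<inter> space (lborel \<Otimes>\<^sub>M lborel) = {Re l<..<Re u} \<times> {Im l<..<Im u}"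
      by (auto simp: box_def Basis_complex_def space_pair_measure)
    then show "emeasure (distr (lborel \<Otimes>\<^sub>M lborel) borel (\<lambda>(x, y). Complex x y)) (box l u)
        = (\<Prod>b\<in>Basis. (u - l) \<bullet> b)"
      using le by (simp add: emeasure_distr lborel.emeasure_pair_measure_Times Basis_complex_def ennreal_mult)
  qed simp
  from arg_cong[OF this, of "\<lambda>M. nn_integral M f"]
  have "(\<integral>\<^sup>+z. f z \<partial>lborel) = (\<integral>\<^sup>+p. f (case p of (x, y) \<Rightarrow> Complex x y) \<partial>(lborel \<Otimes>\<^sub>M lborel))"
    by (simp add: nn_integral_distr)
  also have "\<dots> = (\<integral>\<^sup>+x. \<integral>\<^sup>+y. f (Complex x y) \<partial>lborel \<partial>lborel)"
    by (subst lborel.nn_integral_fst[symmetric]) auto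
  finally show 1: "(\<integral>\<^sup>+z. f z \<partial>lborel) = (\<integral>\<^sup>+x. \<integral>\<^sup>+y. f (Complex x y) \<partial>lborel \<partial>lborel)" .
  have "(\<lambda>(x, y). f (Complex x y)) \<in> borel_measurable (lborel \<Otimes>\<^sub>M lborel)"
    using measurable_compose[of "\<lambda>(x, y). Complex x y" "borel \<Otimes>\<^sub>M borel" borel f borel]
    by (simp add: split_beta')
  from lborel_pair.Fubini'[OF this] show "(\<integral>\<^sup>+z. f z \<partial>lborel) = (\<integral>\<^sup>+y. \<integral>\<^sup>+x. f (Complex x y) \<partial>lborel \<partial>lborel)"
    by (simp add: 1)
qed

text \<open>A shear translates one coordinate by an amount depending only on the other, so
  translation invariance applies in the inner integral.\<close>

lemma nn_integral_lborel_shear: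
  fixes f :: "complex \<Rightarrow> ennreal"
  assumes [measurable]: "f \<in> borel_measurable borel"
  shows "(\<integral>\<^sup>+z. f (z + of_real (t * Im z)) \<partial>lborel) = (\<integral>\<^sup>+z. f z \<partial>lborel)"
    and "(\<integral>\<^sup>+z. f (z + \<i> * of_real (t * Re z)) \<partial>lborel) = (\<integral>\<^sup>+z. f z \<partial>lborel)"
proof -
  have [measurable]: "(\<lambda>x. Complex x y) \<in> borel_measurable borel" "(\<lambda>x. Complex y x) \<in> borel_measurable borel" for y
    by (intro borel_measurable_continuous_onI; auto simp: Complex_eq intro!: continuous_intros)+
  have "(\<integral>\<^sup>+x. f (Complex (x + t * y) y) \<partial>lborel) = (\<integral>\<^sup>+x. f (Complex x y) \<partial>lborel)" for y
    using nn_integral_real_affine[of "\<lambda>x. f (Complex x y)" 1 "t * y"] by (simp add: add.commute)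
  moreover have "Complex x y + of_real (t * y) = Complex (x + t * y) y" for x y
    by (simp add: complex_eq_iff)
  ultimately show "(\<integral>\<^sup>+z. f (z + of_real (t * Im z)) \<partial>lborel) = (\<integral>\<^sup>+z. f z \<partial>lborel)"
    by (simp add: nn_integral_lborel_complex(2))
  have "(\<integral>\<^sup>+y. f (Complex x (y + t * x)) \<partial>lborel) = (\<integral>\<^sup>+y. f (Complex x y) \<partial>lborel)" for x
    using nn_integral_real_affine[of "\<lambda>y. f (Complex x y)" 1 "t * x"] by (simp add: add.commute)
  moreover have "Complex x y + \<i> * of_real (t * x) = Complex x (y + t * x)" for x y
    by (simp add: complex_eq_iff)
  ultimately show "(\<integral>\<^sup>+z. f (z + \<i> * of_real (t * Re z)) \<partial>lborel) = (\<integral>\<^sup>+z. f z \<partial>lborel)"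
    by (simp add: nn_integral_lborel_complex(1))
qed

text \<open>A rotation other than \<open>z \<mapsto> - z\<close> is the product of three shears.\<close>

lemma nn_integral_lborel_rotation:
  fixes f :: "complex \<Rightarrow> ennreal"
  assumes f [measurable]: "f \<in> borel_measurable borel" and c: "cmod c = 1" "Re c \<noteq> - 1"
  shows "(\<integral>\<^sup>+z. f (c * z) \<partial>lborel) = (\<integral>\<^sup>+z. f z \<partial>lborel)"
proof -
  \<comment> \<open>For \<open>c = cis \<phi>\<close> this is minus the tangent of half the angle,
    the parameter of the two outer shears; it is the reason for excluding
    \<open>c = -1\<close>.\<close>
  define t where "t = - Im c / (1 + Re c)"
  define A where "A = (\<lambda>z. z + complex_of_real (t * Im z))"
  define B where "B = (\<lambda>z. z + \<i> * complex_of_real (Im c * Re z))"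
  have [measurable]: "A \<in> borel_measurable borel" "B \<in> borel_measurable borel"
    by (simp_all add: A_def B_def)
  have n0: "1 + Re c \<noteq> 0"
    using c by linarith
  have "(Re c)\<^sup>2 + (Im c)\<^sup>2 = 1"
    using c by (simp add: cmod_def)
  then have "(Im c)\<^sup>2 = (1 - Re c) * (1 + Re c)"
    by (simp add: power2_eq_square algebra_simps)
  then have 1: "1 + t * Im c = Re c"
    using n0 by (simp add: t_def power2_eq_square)
  have "t * (1 + Re c) = - Im c"
    using n0 by (simp add: t_def)
  then have 2: "t + t * (1 + t * Im c) = - Im c"
    by (simp add: 1 algebra_simps)
  have "A (B (A z)) = c * z" for z
  proof -
    have "Re (A (B (A z))) = Re z * (1 + t * Im c) + Im z * (t + t * (1 + t * Im c))"
      "Im (A (B (A z))) = Im c * Re z + Im z * (1 + t * Im c)"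
      by (simp_all add: A_def B_def algebra_simps)
    then show ?thesis
      unfolding 2 unfolding 1 by (simp add: complex_eq_iff algebra_simps)
  qed
  then have "(\<integral>\<^sup>+z. f (c * z) \<partial>lborel) = (\<integral>\<^sup>+z. f (A (B (A z))) \<partial>lborel)"
    by simp
  also have "\<dots> = (\<integral>\<^sup>+z. f (A (B z)) \<partial>lborel)"
    using nn_integral_lborel_shear(1)[of "\<lambda>z. f (A (B z))" t] by (simp add: A_def)
  also have "\<dots> = (\<integral>\<^sup>+z. f (A z) \<partial>lborel)"
    using nn_integral_lborel_shear(2)[of "\<lambda>z. f (A z)" "Im c"] by (simp add: B_def)
  also have "\<dots> = (\<integral>\<^sup>+z. f z \<partial>lborel)"
    using nn_integral_lborel_shear(1)[of f t] by (simp add: A_def)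
  finally show ?thesis .
qed

text \<open>A disc of radius \<open>sqrt x\<close> has area \<open>pi * x\<close>, so the two
  measures agree on the half-lines, which generate the Borel sets. This serves in place of polar
  coordinates.\<close>

lemma distr_norm_power2_lborel:
  "distr lborel borel (\<lambda>z::complex. (cmod z)\<^sup>2) = density lborel (\<lambda>r. ennreal pi * indicator {0<..} r)"
proof (rule measure_eqI_generator_eq)
  let ?E = "range lessThan :: real set set"
  show "Int_stable ?E"
  proof -
    have "{..<a} \<inter> {..<b} = {..<min a b}" for a b :: real
      by auto
    then show ?thesis
      by (auto simp: Int_stable_def)
  qed
  show "sets (distr lborel borel (\<lambda>z::complex. (cmod z)\<^sup>2)) = sigma_sets UNIV ?E"
    "sets (density lborel (\<lambda>r. ennreal pi * indicator {0<..} r)) = sigma_sets UNIV ?E"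
    by (simp_all add: borel_Iio)
  have eq: "emeasure (distr lborel borel (\<lambda>z::complex. (cmod z)\<^sup>2)) {..<x} = ennreal (pi * max 0 x)" for x
  proof -
    \<comment> \<open>The \<open>max 0 x\<close> covers negative \<open>x\<close>, where the
      preimage is empty and so is the ball of radius 0.\<close>
    have "(\<lambda>z::complex. (cmod z)\<^sup>2) -` {..<x} = ball 0 (sqrt (max 0 x))"
    proof (intro antisym subsetI)
      fix z assume "z \<in> (\<lambda>z::complex. (cmod z)\<^sup>2) -` {..<x}"
      then have "(cmod z)\<^sup>2 < max 0 x" by auto
      then show "z \<in> ball 0 (sqrt (max 0 x))"
        by (simp add: real_less_rsqrt)
    next
      fix z :: complex assume "z \<in> ball 0 (sqrt (max 0 x))"
      then have "cmod z < sqrt (max 0 x)" by simp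
      then have "(cmod z)\<^sup>2 < (sqrt (max 0 x))\<^sup>2"
        by (intro power_strict_mono) auto
      then show "z \<in> (\<lambda>z::complex. (cmod z)\<^sup>2) -` {..<x}"
        using zero_le_power2[of "cmod z"] by (simp add: max_def split: if_splits)
    qed
    then show ?thesis
      by (simp add: emeasure_distr emeasure_ball unit_ball_vol_2)
  qed
  fix X assume "X \<in> ?E"
  then obtain x where x: "X = {..<x}" by auto
  have "emeasure (density lborel (\<lambda>r. ennreal pi * indicator {0<..} r)) {..<x}
      = (\<integral>\<^sup>+r. ennreal pi * indicator {0<..<x} r \<partial>lborel)"
    by (subst emeasure_density) (auto intro!: nn_integral_cong simp: indicator_def)
  also have "\<dots> = ennreal pi * emeasure lborel {0<..<x}"
    by (simp add: nn_integral_cmult)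
  also have "\<dots> = ennreal (pi * max 0 x)"
    by (cases "x \<ge> 0") (auto simp: ennreal_mult)
  finally show "emeasure (distr lborel borel (\<lambda>z::complex. (cmod z)\<^sup>2)) X
      = emeasure (density lborel (\<lambda>r. ennreal pi * indicator {0<..} r)) X"
    by (simp add: eq x)
next
  show "range (\<lambda>i::nat. {..<real i}) \<subseteq> range lessThan" "(\<Union>i::nat. {..<real i}) = UNIV"
    by (auto simp: reals_Archimedean2)
  show "emeasure (distr lborel borel (\<lambda>z::complex. (cmod z)\<^sup>2)) {..<real i} \<noteq> \<infinity>" for i
  proof -
    have "(\<lambda>z::complex. (cmod z)\<^sup>2) -` {..<real i} \<subseteq> ball 0 (real i + 1)"
    proof
      fix z :: complex assume "z \<in> (\<lambda>z::complex. (cmod z)\<^sup>2) -` {..<real i}"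
      then have "(cmod z)\<^sup>2 < (real i + 1)\<^sup>2"
        by (simp add: power2_sum) (use zero_le_power2[of "real i"] in linarith)
      then show "z \<in> ball 0 (real i + 1)"
        by (simp add: power2_less_imp_less)
    qed
    then have "emeasure lborel ((\<lambda>z::complex. (cmod z)\<^sup>2) -` {..<real i}) \<le> emeasure lborel (ball (0::complex) (real i + 1))"
      by (intro emeasure_mono) auto
    also have "\<dots> < \<infinity>"
      by (simp add: emeasure_ball)
    finally show ?thesis
      by (simp add: emeasure_distr)
  qed
qed simp

lemma nn_integral_lborel_radial:
  assumes [measurable]: "f \<in> borel_measurable borel"
  shows "(\<integral>\<^sup>+z. f ((cmod z)\<^sup>2) \<partial>lborel) = ennreal pi * (\<integral>\<^sup>+r. f r * indicator {0<..} r \<partial>lborel)"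
proof -
  have "(\<integral>\<^sup>+z. f ((cmod z)\<^sup>2) \<partial>lborel) = (\<integral>\<^sup>+r. f r \<partial>distr lborel borel (\<lambda>z::complex. (cmod z)\<^sup>2))"
    by (simp add: nn_integral_distr)
  also have "\<dots> = ennreal pi * (\<integral>\<^sup>+r. f r * indicator {0<..} r \<partial>lborel)"
    by (simp add: distr_norm_power2_lborel nn_integral_density nn_integral_cmult mult_ac)
  finally show ?thesis .
qed

lemma nn_integral_Gamma_scaled:
  fixes \<nu> \<eta> :: real
  assumes "\<nu> > 0" "\<eta> > 0"
  shows "(\<integral>\<^sup>+t. ennreal (t powr (\<nu> - 1) * exp (- t / \<eta>)) * indicator {0<..} t \<partial>lborel) = ennreal (\<eta> powr \<nu> * Gamma \<nu>)"
proof -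
  have "(\<integral>\<^sup>+t. ennreal (t powr (\<nu> - 1) * exp (- t / \<eta>)) * indicator {0<..} t \<partial>lborel)
    = ennreal \<eta> * (\<integral>\<^sup>+t. ennreal ((\<eta> * t) powr (\<nu> - 1) * exp (- (\<eta> * t) / \<eta>)) * indicator {0<..} (\<eta> * t) \<partial>lborel)"
    using assms by (subst nn_integral_real_affine[where c = \<eta> and t = 0]) auto
  also have "\<dots> = (\<integral>\<^sup>+t. ennreal (\<eta> powr \<nu>) * ennreal (indicator {0<..} t *\<^sub>R (exp (- t) * t powr (\<nu> - 1))) \<partial>lborel)"
  proof (subst nn_integral_cmult[symmetric], measurable, intro nn_integral_cong)
    fix t :: real
    have "\<eta> powr \<nu> = \<eta> * \<eta> powr (\<nu> - 1)"
      using assms by (simp add: powr_diff)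
    then show "ennreal \<eta> * (ennreal ((\<eta> * t) powr (\<nu> - 1) * exp (- (\<eta> * t) / \<eta>)) * indicator {0<..} (\<eta> * t))
      = ennreal (\<eta> powr \<nu>) * ennreal (indicator {0<..} t *\<^sub>R (exp (- t) * t powr (\<nu> - 1)))"
      using assms by (auto simp: indicator_def zero_less_mult_iff powr_mult ennreal_mult'[symmetric] mult_ac)
  qed
  also have "\<dots> = ennreal (\<eta> powr \<nu>) * ennreal (Gamma \<nu>)"
    using has_bochner_integral_Gamma[OF assms(1)]
    by (subst nn_integral_cmult) (auto simp: has_bochner_integral_iff nn_integral_eq_integral)
  finally show ?thesis
    by (simp add: ennreal_mult')
qed

section \<open>The mixture of Gaussian measures\<close>

lemma emeasure_nu_measure:
  assumes "A \<in> sets borel"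
  shows "emeasure (nu_measure r) A
    = (\<integral>\<^sup>+z. ennreal (1 / (pi * r) * exp (- (cmod z)\<^sup>2 / r)) * indicator A z \<partial>lborel)"
  using assms unfolding nu_measure_def by (subst emeasure_density) auto

text \<open>Under the Gaussian measure the squared modulus is exponentially distributed with mean
  \<open>r\<close>; these are its moments.\<close>

lemma nn_integral_nu_measure_norm_power:
  assumes r: "r > 0"
  shows "(\<integral>\<^sup>+z. ennreal (cmod z ^ (2 * n)) \<partial>nu_measure r) = ennreal (fact n * r ^ n)"
proof -
  have "(\<integral>\<^sup>+z. ennreal (cmod z ^ (2 * n)) \<partial>nu_measure r)
      = (\<integral>\<^sup>+z. ennreal (1 / (pi * r) * exp (- (cmod z)\<^sup>2 / r) * ((cmod z)\<^sup>2) ^ n) \<partial>lborel)"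
    unfolding nu_measure_def using r
    by (subst nn_integral_density) (auto simp: ennreal_mult'[symmetric] power_mult intro!: nn_integral_cong)
  also have "\<dots> = ennreal pi * (\<integral>\<^sup>+s. ennreal (1 / (pi * r) * exp (- s / r) * s ^ n) * indicator {0<..} s \<partial>lborel)"
    by (rule nn_integral_lborel_radial) measurable
  also have "(\<integral>\<^sup>+s. ennreal (1 / (pi * r) * exp (- s / r) * s ^ n) * indicator {0<..} s \<partial>lborel)
      = (\<integral>\<^sup>+s. ennreal (1 / (pi * r)) * (ennreal (s powr (real (Suc n) - 1) * exp (- s / r)) * indicator {0<..} s) \<partial>lborel)"
    using r by (intro nn_integral_cong) (auto simp: indicator_def ennreal_mult'[symmetric] powr_realpow mult_ac)
  also have "\<dots> = ennreal (1 / (pi * r)) *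
      (\<integral>\<^sup>+s. ennreal (s powr (real (Suc n) - 1) * exp (- s / r)) * indicator {0<..} s \<partial>lborel)"
    by (rule nn_integral_cmult) measurable
  also have "(\<integral>\<^sup>+s. ennreal (s powr (real (Suc n) - 1) * exp (- s / r)) * indicator {0<..} s \<partial>lborel)
      = ennreal (r powr real (Suc n) * Gamma (real (Suc n)))"
    using r by (intro nn_integral_Gamma_scaled) auto
  also have "Gamma (real (Suc n)) = fact n"
    using Gamma_fact[of n, where 'a = real] by simp
  also have "r powr real (Suc n) = r * r ^ n"
    using r by (simp only: powr_realpow power_Suc)
  also have "ennreal pi * (ennreal (1 / (pi * r)) * ennreal (r * r ^ n * fact n)) = ennreal (fact n * r ^ n)"
    using r by (simp add: ennreal_mult'[symmetric])
  finally show ?thesis .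
qed

lemma prob_space_nu_measure:
  assumes "r > 0"
  shows "prob_space (nu_measure r)"
proof
  show "emeasure (nu_measure r) (space (nu_measure r)) = 1"
    using nn_integral_nu_measure_norm_power[OF assms, of 0] by (simp add: nu_measure_def)
qed

text \<open>The bind operation needs a kernel on the whole line. For \<open>r < 0\<close> the
  density is truncated to 0, and for \<open>r = 0\<close> division by zero does the same, so the
  kernel is sub-probabilistic everywhere.\<close>

lemma nu_measure_nonpos:
  assumes "r \<le> 0"
  shows "emeasure (nu_measure r) A = 0"
proof -
  have eq: "ennreal (1 / (pi * r) * exp (- (cmod z)\<^sup>2 / r)) = 0" for z
    using assms by (intro ennreal_neg mult_nonpos_nonneg) (auto simp: divide_le_0_iff mult_le_0_iff)
  show ?thesis
  proof (cases "A \<in> sets borel")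
    case True
    show ?thesis
      unfolding emeasure_nu_measure[OF True] eq by simp
  qed (simp add: emeasure_notin_sets nu_measure_def)
qed

lemma measurable_nu_measure: "nu_measure \<in> borel \<rightarrow>\<^sub>M subprob_algebra borel"
proof (rule measurable_subprob_algebra)
  fix r :: real
  show "sets (nu_measure r) = sets borel"
    by (simp add: nu_measure_def)
  show "subprob_space (nu_measure r)"
  proof (cases "r > 0")
    case False
    show ?thesis
      by (rule subprob_spaceI) (use False in \<open>auto simp: nu_measure_nonpos, simp add: nu_measure_def\<close>)
  qed (intro prob_space_imp_subprob_space prob_space_nu_measure)
next
  fix A :: "complex set" assume A [measurable]: "A \<in> sets borel"
  have "(\<lambda>r. \<integral>\<^sup>+z. ennreal (1 / (pi * r) * exp (- (cmod z)\<^sup>2 / r)) * indicator A z \<partial>lborel) \<in> borel_measurable borel"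
    by measurable
  then show "(\<lambda>r. emeasure (nu_measure r) A) \<in> borel_measurable borel"
    by (simp add: emeasure_nu_measure)
qed

lemma sets_mu_measure [simp, measurable_cong]: "sets (mu_measure \<eta> \<sigma>) = sets borel"
  by (simp add: mu_measure_def)

lemma measurable_nu_measure_mu [measurable]: "nu_measure \<in> mu_measure \<eta> \<sigma> \<rightarrow>\<^sub>M subprob_algebra borel"
  using measurable_nu_measure by (simp cong: measurable_cong_sets)

lemma space_mu_measure [simp]: "space (mu_measure \<eta> \<sigma>) = UNIV"
  by (simp add: mu_measure_def)

lemma sets_lambda_measure [simp, measurable_cong]: "sets (lambda_measure \<eta> \<sigma>) = sets borel"
  unfolding lambda_measure_def by (rule sets_bind_measurable[OF measurable_nu_measure_mu]) simp

lemma nn_integral_mu_measure: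
  assumes [measurable]: "f \<in> borel_measurable borel"
  shows "(\<integral>\<^sup>+r. f r \<partial>mu_measure \<eta> \<sigma>) = (\<integral>\<^sup>+r. ennreal (1 / Gamma (\<sigma> / \<eta>) * \<eta> powr (- \<sigma> / \<eta>)
     * r powr (-1 + \<sigma> / \<eta>) * exp (- r / \<eta>)) * indicator {0<..} r * f r \<partial>lborel)"
  unfolding mu_measure_def by (subst nn_integral_density) auto

lemma borel_measurable_lambda_density [measurable]: "lambda_density \<eta> \<sigma> \<in> borel_measurable borel"
  unfolding lambda_density_def [abs_def] by measurable

text \<open>Tonelli's theorem exchanges the mixing variable with the point of the plane. The factor
  \<open>1 / r\<close> of the Gaussian lowers the gamma exponent to
  \<open>-2 + \<sigma> / \<eta>\<close>.\<close>

lemma lambda_measure_eq_density: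
  assumes "\<eta> > 0" "\<sigma> > 0"
  shows "lambda_measure \<eta> \<sigma> = density lborel (lambda_density \<eta> \<sigma>)"
proof (rule measure_eqI)
  fix A assume "A \<in> sets (lambda_measure \<eta> \<sigma>)"
  then have A [measurable]: "A \<in> sets borel" by simp
  let ?C = "1 / (pi * Gamma (\<sigma> / \<eta>)) * \<eta> powr (- \<sigma> / \<eta>)"
  let ?k = "\<lambda>z r. ennreal (exp (- (cmod z)\<^sup>2 / r - r / \<eta>) * r powr (-2 + \<sigma> / \<eta>)) * indicator {0<..} r"
  let ?m = "\<lambda>r. ennreal (1 / Gamma (\<sigma> / \<eta>) * \<eta> powr (- \<sigma> / \<eta>)
     * r powr (-1 + \<sigma> / \<eta>) * exp (- r / \<eta>)) * indicator {0<..} r"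
  let ?n = "\<lambda>r z. ennreal (1 / (pi * r) * exp (- (cmod z)\<^sup>2 / r))"
  have eq: "?m r * (?n r z * indicator A z) = ennreal ?C * (?k z r * indicator A z)" for r z
  proof (cases "r > 0")
    case True
    have G: "Gamma (\<sigma> / \<eta>) > 0"
      using assms by simp
    have "r powr (-1 + \<sigma> / \<eta>) = r * r powr (-2 + \<sigma> / \<eta>)"
      using powr_mult_base[of r "-2 + \<sigma> / \<eta>"] True by (simp add: add.commute)
    moreover have "exp (- (cmod z)\<^sup>2 / r - r / \<eta>) = exp (- r / \<eta>) * exp (- (cmod z)\<^sup>2 / r)"
      by (simp add: exp_add[symmetric])
    ultimately have "1 / Gamma (\<sigma> / \<eta>) * \<eta> powr (- \<sigma> / \<eta>) * r powr (-1 + \<sigma> / \<eta>) * exp (- r / \<eta>)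
        * (1 / (pi * r) * exp (- (cmod z)\<^sup>2 / r))
      = ?C * (exp (- (cmod z)\<^sup>2 / r - r / \<eta>) * r powr (-2 + \<sigma> / \<eta>))"
      using True G by (simp add: field_simps)
    \<comment> \<open>The real identity between the kernels is carried to \<open>ennreal\<close> in
      abstract form; \<open>i\<close> stands for the indicator of \<open>A\<close>, and the factors
      1 are the indicators of the half-line.\<close>
    moreover have "ennreal M * 1 * (ennreal N * i) = ennreal C * (ennreal K * 1 * i)"
      if "M * N = C * K" "M \<ge> 0" "C \<ge> 0" for M N C K and i :: ennreal
      using that by (simp add: mult.assoc[symmetric] ennreal_mult'[symmetric])
    moreover have "indicator {0<..} r = (1 :: ennreal)"
      using True by simp
    ultimately show ?thesis
      using True G by (simp only:) simp
  qed simp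
  have "emeasure (lambda_measure \<eta> \<sigma>) A = (\<integral>\<^sup>+r. ?m r * emeasure (nu_measure r) A \<partial>lborel)"
    unfolding lambda_measure_def
    by (subst emeasure_bind[OF _ measurable_nu_measure_mu A])
      (simp, intro nn_integral_mu_measure measurable_emeasure_kernel[OF measurable_nu_measure A])
  also have "\<dots> = (\<integral>\<^sup>+r. \<integral>\<^sup>+z. ?m r * (?n r z * indicator A z) \<partial>lborel \<partial>lborel)"
    by (subst nn_integral_cmult) (auto simp: emeasure_nu_measure)
  also have "\<dots> = (\<integral>\<^sup>+z. \<integral>\<^sup>+r. ?m r * (?n r z * indicator A z) \<partial>lborel \<partial>lborel)"
    by (rule pair_sigma_finite.Fubini') (auto intro!: pair_sigma_finite.intro lborel.sigma_finite_measure_axioms)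
  also have "\<dots> = (\<integral>\<^sup>+z. lambda_density \<eta> \<sigma> z * indicator A z \<partial>lborel)"
    unfolding eq lambda_density_def
    by (intro nn_integral_cong)
      (subst nn_integral_cmult, measurable, subst nn_integral_multc, measurable, simp add: mult.assoc)
  also have "\<dots> = emeasure (density lborel (lambda_density \<eta> \<sigma>)) A"
    by (simp add: emeasure_density)
  finally show "emeasure (lambda_measure \<eta> \<sigma>) A = emeasure (density lborel (lambda_density \<eta> \<sigma>)) A" .
qed simp

section \<open>Moments and rotation invariance of the mixture\<close>

lemma gen_factorial_eq_Gamma:
  assumes "\<eta> > 0" "\<sigma> > 0"
  shows "gen_factorial \<sigma> (- \<eta>) n = \<eta> ^ n * Gamma (\<sigma> / \<eta> + real n) / Gamma (\<sigma> / \<eta>)"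
proof -
  have "gen_factorial \<sigma> (- \<eta>) n = (\<Prod>k<n. \<eta> * (\<sigma> / \<eta> + real k))"
    using assms unfolding gen_factorial_def by (intro prod.cong) (auto simp: distrib_left)
  also have "\<dots> = \<eta> ^ n * pochhammer (\<sigma> / \<eta>) n"
    by (simp add: prod.distrib pochhammer_prod atLeast0LessThan)
  also have "pochhammer (\<sigma> / \<eta>) n = Gamma (\<sigma> / \<eta> + real n) / Gamma (\<sigma> / \<eta>)"
    using assms by (intro pochhammer_Gamma) (auto dest!: nonpos_Ints_nonpos simp: divide_le_0_iff)
  finally show ?thesis by simp
qed

text \<open>The Gaussian moment contributes \<open>fact n * r ^ n\<close>, and the n-th moment of
  the gamma law is the rising factorial. This is where the weight of the Hilbert space meets the
  measure.\<close>

lemma nn_integral_lambda_measure_norm_power: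
  assumes "\<eta> > 0" "\<sigma> > 0"
  shows "(\<integral>\<^sup>+z. ennreal (cmod z ^ (2 * n)) \<partial>lambda_measure \<eta> \<sigma>)
    = ennreal (fact n * gen_factorial \<sigma> (- \<eta>) n)"
proof -
  let ?m = "\<lambda>r. ennreal (1 / Gamma (\<sigma> / \<eta>) * \<eta> powr (- \<sigma> / \<eta>)
     * r powr (-1 + \<sigma> / \<eta>) * exp (- r / \<eta>)) * indicator {0<..} r"
  have G: "Gamma (\<sigma> / \<eta>) > 0"
    using assms by simp
  have "(\<integral>\<^sup>+z. ennreal (cmod z ^ (2 * n)) \<partial>lambda_measure \<eta> \<sigma>)
      = (\<integral>\<^sup>+r. \<integral>\<^sup>+z. ennreal (cmod z ^ (2 * n)) \<partial>nu_measure r \<partial>mu_measure \<eta> \<sigma>)"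
    unfolding lambda_measure_def by (rule nn_integral_bind[OF _ measurable_nu_measure_mu]) simp
  also have "\<dots> = (\<integral>\<^sup>+r. ?m r * (\<integral>\<^sup>+z. ennreal (cmod z ^ (2 * n)) \<partial>nu_measure r) \<partial>lborel)"
    by (intro nn_integral_mu_measure nn_integral_measurable_subprob_algebra2 [OF _ measurable_nu_measure]) simp
  also have "\<dots> = (\<integral>\<^sup>+r. ennreal (fact n / Gamma (\<sigma> / \<eta>) * \<eta> powr (- \<sigma> / \<eta>)) *
      (ennreal (r powr (\<sigma> / \<eta> + real n - 1) * exp (- r / \<eta>)) * indicator {0<..} r) \<partial>lborel)"
  proof (intro nn_integral_cong)
    fix r :: real
    show "?m r * (\<integral>\<^sup>+z. ennreal (cmod z ^ (2 * n)) \<partial>nu_measure r)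
      = ennreal (fact n / Gamma (\<sigma> / \<eta>) * \<eta> powr (- \<sigma> / \<eta>)) *
      (ennreal (r powr (\<sigma> / \<eta> + real n - 1) * exp (- r / \<eta>)) * indicator {0<..} r)"
    proof (cases "r > 0")
      case True
      have "r powr (\<sigma> / \<eta> + real n - 1) = r powr (-1 + \<sigma> / \<eta>) * r ^ n"
        using True by (simp add: powr_realpow[symmetric] powr_add[symmetric] algebra_simps)
      then show ?thesis
        unfolding nn_integral_nu_measure_norm_power[OF True]
        using True G by (simp add: ennreal_mult'[symmetric] mult_ac)
    qed simp
  qed
  also have "\<dots> = ennreal (fact n / Gamma (\<sigma> / \<eta>) * \<eta> powr (- \<sigma> / \<eta>)) * ennreal (\<eta> powr (\<sigma> / \<eta> + n) * Gamma (\<sigma> / \<eta> + n))"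
    using assms by (subst nn_integral_cmult, measurable, subst nn_integral_Gamma_scaled)
      (auto simp: add_pos_nonneg)
  also have "\<dots> = ennreal (fact n / Gamma (\<sigma> / \<eta>) * \<eta> powr (- \<sigma> / \<eta>) * (\<eta> powr (\<sigma> / \<eta> + n) * Gamma (\<sigma> / \<eta> + n)))"
    using G by (intro ennreal_mult'[symmetric]) simp
  also have "\<eta> powr (\<sigma> / \<eta> + n) = \<eta> powr (\<sigma> / \<eta>) * \<eta> ^ n"
    using assms by (simp add: powr_add powr_realpow)
  also have "fact n / Gamma (\<sigma> / \<eta>) * \<eta> powr (- \<sigma> / \<eta>) * (\<eta> powr (\<sigma> / \<eta>) * \<eta> ^ n * Gamma (\<sigma> / \<eta> + n))
      = fact n * gen_factorial \<sigma> (- \<eta>) n"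
    using assms by (simp add: gen_factorial_eq_Gamma powr_minus field_simps)
  finally show ?thesis .
qed

text \<open>The density depends on the modulus only and Lebesgue measure is rotation invariant. The
  excluded half turn is inherited from the decomposition into shears and is harmless for
  orthogonality.\<close>

lemma lambda_measure_rotation:
  assumes "\<eta> > 0" "\<sigma> > 0" "cmod c = 1" "Re c \<noteq> -1"
  shows "distr (lambda_measure \<eta> \<sigma>) borel (\<lambda>z. c * z) = lambda_measure \<eta> \<sigma>"
proof (rule measure_eqI)
  fix A assume "A \<in> sets (distr (lambda_measure \<eta> \<sigma>) borel (\<lambda>z. c * z))"
  then have [measurable]: "A \<in> sets borel" by simp
  have dens: "lambda_density \<eta> \<sigma> (c * z) = lambda_density \<eta> \<sigma> z" for z
    using assms by (simp add: lambda_density_def norm_mult)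
  have "emeasure (distr (lambda_measure \<eta> \<sigma>) borel (\<lambda>z. c * z)) A
      = (\<integral>\<^sup>+z. indicator A (c * z) \<partial>lambda_measure \<eta> \<sigma>)"
    by (simp add: nn_integral_distr flip: nn_integral_indicator)
  also have "\<dots> = (\<integral>\<^sup>+z. lambda_density \<eta> \<sigma> (c * z) * indicator A (c * z) \<partial>lborel)"
    unfolding lambda_measure_eq_density[OF assms(1,2)]
    by (subst nn_integral_density) (auto simp: dens)
  also have "\<dots> = (\<integral>\<^sup>+z. lambda_density \<eta> \<sigma> z * indicator A z \<partial>lborel)"
    by (rule nn_integral_lborel_rotation[OF _ assms(3,4)]) measurable
  also have "\<dots> = emeasure (lambda_measure \<eta> \<sigma>) A"
    unfolding lambda_measure_eq_density[OF assms(1,2)] by (simp add: emeasure_density)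
  finally show "emeasure (distr (lambda_measure \<eta> \<sigma>) borel (\<lambda>z. c * z)) A = emeasure (lambda_measure \<eta> \<sigma>) A" .
qed simp

text \<open>Scaling \<open>r = \<eta> * t\<close> turns the density into the integral of order
  \<open>a - 1\<close> at \<open>s\<close>; the symmetry moves it to order \<open>1 - a\<close>, and
  the rest is bookkeeping of powers.\<close>

lemma lambda_density_eq_bessel_K:
  assumes "\<eta> > 0" "\<sigma> > 0" "z \<noteq> 0"
  shows "lambda_density \<eta> \<sigma> z =
         ennreal (2 * \<eta> powr (- (1 / 2) * (1 + \<sigma> / \<eta>)) / (pi * Gamma (\<sigma> / \<eta>))
           * cmod z powr (\<sigma> / \<eta> - 1) * bessel_K (1 - \<sigma> / \<eta>) (2 * \<eta> powr (- (1 / 2)) * cmod z))"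
proof -
  define a where "a = \<sigma> / \<eta>"
  \<comment> \<open>The argument of K, related to that of the integral by
    \<open>(y / 2)\<^sup>2 = s\<close>.\<close>
  define y where "y = 2 * \<eta> powr (- (1 / 2)) * cmod z"
  define s where "s = (cmod z)\<^sup>2 / \<eta>"
  have s: "s > 0" and y: "y > 0"
    using assms by (simp_all add: s_def y_def)
  have yh: "y / 2 = \<eta> powr (- (1 / 2)) * cmod z"
    by (simp add: y_def)
  have "(\<eta> powr (- (1 / 2)))\<^sup>2 = 1 / \<eta>"
    using assms unfolding power2_eq_square powr_add[symmetric] by (simp add: powr_minus_divide)
  then have ys: "(y / 2)\<^sup>2 = s"
    by (simp only: yh power_mult_distrib) (simp add: s_def)
  have G: "Gamma a > 0"
    using assms by (simp add: a_def)
  have "(\<integral>\<^sup>+ r \<in> {0<..}. ennreal (exp (- (cmod z)\<^sup>2 / r - r / \<eta>) * r powr (-2 + a)) \<partial>lborel)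
    = ennreal \<eta> * (\<integral>\<^sup>+ t. ennreal (exp (- (cmod z)\<^sup>2 / (\<eta> * t) - (\<eta> * t) / \<eta>) * (\<eta> * t) powr (-2 + a)) * indicator {0<..} (\<eta> * t) \<partial>lborel)"
    using assms by (subst nn_integral_real_affine[where c = \<eta> and t = 0]) auto
  also have "\<dots> = (\<integral>\<^sup>+ t. ennreal (\<eta> powr (a - 1)) * ennreal (indicator {0<..} t *\<^sub>R (exp (- s / t - t) * t powr (a - 1 - 1))) \<partial>lborel)"
  proof (subst nn_integral_cmult[symmetric], measurable, intro nn_integral_cong)
    fix t :: real
    have "\<eta> powr (a - 1) = \<eta> * \<eta> powr (-2 + a)"
      using powr_mult_base[of \<eta> "-2 + a"] assms by (simp add: add.commute)
    moreover have "- (cmod z)\<^sup>2 / (\<eta> * t) = - s / t"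
      by (simp add: s_def)
    moreover have "a - 1 - 1 = -2 + a"
      by simp
    ultimately show "ennreal \<eta> * (ennreal (exp (- (cmod z)\<^sup>2 / (\<eta> * t) - (\<eta> * t) / \<eta>) * (\<eta> * t) powr (-2 + a)) * indicator {0<..} (\<eta> * t))
      = ennreal (\<eta> powr (a - 1)) * ennreal (indicator {0<..} t *\<^sub>R (exp (- s / t - t) * t powr (a - 1 - 1)))"
      using assms by (auto simp: indicator_def zero_less_mult_iff powr_mult ennreal_mult'[symmetric] mult_ac)
  qed
  also have "\<dots> = ennreal (\<eta> powr (a - 1)) * ennreal (macdonald (a - 1) s)"
    using set_integrable_macdonald[of s "a - 1"] s
    unfolding macdonald_def set_integrable_def set_lebesgue_integral_def
    by (subst nn_integral_cmult) (auto simp: nn_integral_eq_integral)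
  finally have "lambda_density \<eta> \<sigma> z = ennreal (1 / (pi * Gamma a) * \<eta> powr (- a)) *
      (ennreal (\<eta> powr (a - 1)) * ennreal (macdonald (a - 1) s))"
    by (simp add: lambda_density_def a_def)
  also have "\<dots> = ennreal (1 / (pi * Gamma a) * \<eta> powr (- a) * (\<eta> powr (a - 1) * macdonald (a - 1) s))"
    using G macdonald_nonneg by (simp add: ennreal_mult'[symmetric])
  also have "macdonald (a - 1) s = s powr (a - 1) * macdonald (1 - a) s"
    using macdonald_symm[OF s, of "a - 1"] by simp
  also have "s powr (a - 1) = (y / 2) powr (a - 1) * (y / 2) powr (a - 1)"
    unfolding ys[symmetric] power2_eq_square by (rule powr_mult)
  also have "(y / 2) powr (a - 1) * (y / 2) powr (a - 1) * macdonald (1 - a) s = 2 * (y / 2) powr (a - 1) * bessel_K (1 - a) y"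
    using bessel_K_eq_macdonald[OF y, of "1 - a"] by (simp add: ys)
  also have "(y / 2) powr (a - 1) = \<eta> powr (- (1 / 2) * (a - 1)) * cmod z powr (a - 1)"
    by (simp only: yh powr_mult powr_powr)
  also have "1 / (pi * Gamma a) * \<eta> powr (- a) * (\<eta> powr (a - 1) * (2 * (\<eta> powr (- (1 / 2) * (a - 1)) * cmod z powr (a - 1)) * bessel_K (1 - a) y))
     = 2 * (\<eta> powr (- a) * \<eta> powr (a - 1) * \<eta> powr (- (1 / 2) * (a - 1))) / (pi * Gamma a) * cmod z powr (a - 1) * bessel_K (1 - a) y"
    by simp
  also have "\<eta> powr (- a) * \<eta> powr (a - 1) * \<eta> powr (- (1 / 2) * (a - 1)) = \<eta> powr (- (1 / 2) * (1 + a))"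
  proof -
    have "- a + (a - 1) + - (1 / 2) * (a - 1) = - (1 / 2) * (1 + a)"
      by (simp add: field_simps)
    then show ?thesis
      by (simp only: powr_add[symmetric])
  qed
  finally show ?thesis
    by (simp only: a_def y_def)
qed

text \<open>The value at 0 dominates all others, which bounds the limsup, and Fatou's lemma bounds
  the liminf from below. The argument also covers an infinite value at 0.\<close>

lemma isCont_lambda_density_0:
  assumes "\<eta> > 0"
  shows "isCont (lambda_density \<eta> \<sigma>) 0"
  unfolding continuous_at_sequentially comp_def
proof (intro allI impI)
  fix X :: "nat \<Rightarrow> complex" assume X: "X \<longlonglongrightarrow> 0"
  let ?c = "ennreal (1 / (pi * Gamma (\<sigma> / \<eta>)) * \<eta> powr (- \<sigma> / \<eta>))"
  let ?k = "\<lambda>z r. ennreal (exp (- (cmod z)\<^sup>2 / r - r / \<eta>) * r powr (-2 + \<sigma> / \<eta>)) * indicator {0<..} r"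
  have le: "lambda_density \<eta> \<sigma> z \<le> lambda_density \<eta> \<sigma> 0" for z
    unfolding lambda_density_def
    by (intro mult_left_mono nn_integral_mono) (auto simp: indicator_def intro!: ennreal_leI mult_right_mono)
  have "lambda_density \<eta> \<sigma> 0 = (\<integral>\<^sup>+ r. ?c * ?k 0 r \<partial>lborel)"
    unfolding lambda_density_def by (subst nn_integral_cmult) auto
  also have "\<dots> = (\<integral>\<^sup>+ r. liminf (\<lambda>n. ?c * ?k (X n) r) \<partial>lborel)"
  proof (intro nn_integral_cong lim_imp_Liminf[symmetric])
    fix r :: real
    show "(\<lambda>n. ?c * ?k (X n) r) \<longlonglongrightarrow> ?c * ?k 0 r"
    proof (cases "r > 0")
      case True
      have "(\<lambda>n. exp (- (cmod (X n))\<^sup>2 / r - r / \<eta>) * r powr (-2 + \<sigma> / \<eta>))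
          \<longlonglongrightarrow> exp (- (cmod 0)\<^sup>2 / r - r / \<eta>) * r powr (-2 + \<sigma> / \<eta>)"
        using True by (intro tendsto_intros X) auto
      then have "(\<lambda>n. ?c * ennreal (exp (- (cmod (X n))\<^sup>2 / r - r / \<eta>) * r powr (-2 + \<sigma> / \<eta>)))
          \<longlonglongrightarrow> ?c * ennreal (exp (- (cmod 0)\<^sup>2 / r - r / \<eta>) * r powr (-2 + \<sigma> / \<eta>))"
        by (intro ennreal_tendsto_cmult tendsto_ennrealI) auto
      then show ?thesis
        using True by simp
    qed simp
  qed simp
  also have "\<dots> \<le> liminf (\<lambda>n. \<integral>\<^sup>+ r. ?c * ?k (X n) r \<partial>lborel)"
    by (intro nn_integral_liminf) auto
  also have "\<dots> = liminf (\<lambda>n. lambda_density \<eta> \<sigma> (X n))"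
    unfolding lambda_density_def by (subst nn_integral_cmult) auto
  finally have "lambda_density \<eta> \<sigma> 0 \<le> liminf (\<lambda>n. lambda_density \<eta> \<sigma> (X n))" .
  moreover have "limsup (\<lambda>n. lambda_density \<eta> \<sigma> (X n)) \<le> lambda_density \<eta> \<sigma> 0"
    by (intro Limsup_bounded) (auto intro: le always_eventually)
  ultimately show "(\<lambda>n. lambda_density \<eta> \<sigma> (X n)) \<longlonglongrightarrow> lambda_density \<eta> \<sigma> 0"
    by (metis Liminf_le_Limsup antisym order_trans tendsto_iff_Liminf_eq_Limsup trivial_limit_sequentially)
qed

section \<open>Orthogonal sequences in \<open>L\<^sup>2\<close>\<close>

lemma L2_fun_cmult:
  assumes "f \<in> L2_fun M"
  shows "(\<lambda>x. c * f x) \<in> L2_fun M"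
  using assms by (auto simp: L2_fun_def norm_mult power_mult_distrib)

lemma L2_fun_0: "(\<lambda>x. 0) \<in> L2_fun M"
  by (simp add: L2_fun_def)

lemma L2_fun_add:
  assumes "f \<in> L2_fun M" "g \<in> L2_fun M"
  shows "(\<lambda>x. f x + g x) \<in> L2_fun M"
  using L2_fun_diff[OF assms(1) L2_fun_cmult[OF assms(2), of "-1"]] by simp

lemma L2_fun_sum:
  assumes "\<And>n. n \<in> I \<Longrightarrow> f n \<in> L2_fun M"
  shows "(\<lambda>x. \<Sum>n\<in>I. f n x) \<in> L2_fun M"
  using assms by (induction I rule: infinite_finite_induct) (auto intro: L2_fun_0 L2_fun_add)

lemma integrable_L2_inner:
  assumes f: "f \<in> L2_fun M" and g: "g \<in> L2_fun M"
  shows "integrable M (\<lambda>x. f x * cnj (g x))"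
proof (rule Bochner_Integration.integrable_bound[OF L2_integrable_mult[OF f g]])
  have [measurable]: "f \<in> borel_measurable M" "g \<in> borel_measurable M"
    using f g by (auto simp: L2_fun_def)
  have [measurable]: "cnj \<in> borel_measurable borel"
    by (intro borel_measurable_continuous_onI continuous_intros)
  show "(\<lambda>x. f x * cnj (g x)) \<in> borel_measurable M"
    by measurable
qed (simp add: norm_mult)

lemma L2_norm_nonneg: "L2_norm M f \<ge> 0"
  by (simp add: L2_norm_def)

lemma L2_norm_power2: "(L2_norm M f)\<^sup>2 = (\<integral>x. (cmod (f x))\<^sup>2 \<partial>M)"
  by (simp add: L2_norm_def)

lemma L2_inner_self: "L2_inner M f f = of_real ((L2_norm M f)\<^sup>2)"
  unfolding L2_inner_def L2_norm_power2 complex_norm_square[symmetric] by (rule integral_complex_of_real)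

lemma L2_inner_commute: "L2_inner M g f = cnj (L2_inner M f g)"
  unfolding L2_inner_def by (subst Bochner_Integration.integral_cnj[symmetric]) (simp add: mult.commute)

lemma L2_inner_diff_left:
  assumes "f \<in> L2_fun M" "g \<in> L2_fun M" "h \<in> L2_fun M"
  shows "L2_inner M (\<lambda>x. f x - g x) h = L2_inner M f h - L2_inner M g h"
  using assms by (simp add: L2_inner_def left_diff_distrib integrable_L2_inner)

lemma L2_inner_diff_right:
  assumes "f \<in> L2_fun M" "g \<in> L2_fun M" "h \<in> L2_fun M"
  shows "L2_inner M h (\<lambda>x. f x - g x) = L2_inner M h f - L2_inner M h g"
  using assms by (simp add: L2_inner_def right_diff_distrib integrable_L2_inner)

lemma L2_inner_sum_left:
  assumes "\<And>n. n \<in> I \<Longrightarrow> e n \<in> L2_fun M" "h \<in> L2_fun M"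
  shows "L2_inner M (\<lambda>x. \<Sum>n\<in>I. a n * e n x) h = (\<Sum>n\<in>I. a n * L2_inner M (e n) h)"
  using assms by (simp add: L2_inner_def sum_distrib_right mult.assoc integrable_L2_inner)

lemma L2_inner_sum_right:
  assumes "\<And>n. n \<in> I \<Longrightarrow> e n \<in> L2_fun M" "h \<in> L2_fun M"
  shows "L2_inner M h (\<lambda>x. \<Sum>n\<in>I. a n * e n x) = (\<Sum>n\<in>I. cnj (a n) * L2_inner M h (e n))"
  using L2_inner_sum_left[of I e M h a] assms
  by (subst L2_inner_commute) (simp add: L2_inner_commute[of M _ h])

text \<open>A crude substitute for the Cauchy-Schwarz inequality, enough to send an inner product to
  0 when both norms tend to 0.\<close>

lemma norm_L2_inner_le:
  assumes f: "f \<in> L2_fun M" and g: "g \<in> L2_fun M"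
  shows "cmod (L2_inner M f g) \<le> (L2_norm M f)\<^sup>2 + (L2_norm M g)\<^sup>2"
proof -
  have "cmod (L2_inner M f g) \<le> (\<integral>x. cmod (f x * cnj (g x)) \<partial>M)"
    unfolding L2_inner_def by (rule integral_norm_bound)
  also have "\<dots> \<le> (\<integral>x. (cmod (f x))\<^sup>2 + (cmod (g x))\<^sup>2 \<partial>M)"
  proof (rule integral_mono)
    fix x
    show "cmod (f x * cnj (g x)) \<le> (cmod (f x))\<^sup>2 + (cmod (g x))\<^sup>2"
      using sum_squares_bound[of "cmod (f x)" "cmod (g x)"]
        mult_nonneg_nonneg[OF norm_ge_zero[of "f x"] norm_ge_zero[of "g x"]] unfolding norm_mult complex_mod_cnj by linarith
  qed (use f g integrable_norm[OF integrable_L2_inner[OF f g]] in \<open>auto simp: L2_fun_def\<close>)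
  also have "\<dots> = (L2_norm M f)\<^sup>2 + (L2_norm M g)\<^sup>2"
    unfolding L2_norm_power2 using f g by (simp add: L2_fun_def)
  finally show ?thesis .
qed

text \<open>The sequence is not normalised, so that for monomials the expansion coefficients are the
  Taylor coefficients themselves and \<open>w\<close> is the weight of the Hilbert space.\<close>

locale L2_orthogonal =
  fixes M :: "'a measure" and e :: "nat \<Rightarrow> 'a \<Rightarrow> complex" and w :: "nat \<Rightarrow> real"
  assumes e: "e n \<in> L2_fun M"
    and w_pos: "w n > 0"
    and orth: "L2_inner M (e m) (e n) = (if m = n then of_real (w n) else 0)"
begin

lemma sum_in_L2: "(\<lambda>x. \<Sum>n\<in>I. a n * e n x) \<in> L2_fun M"
  by (intro L2_fun_sum L2_fun_cmult e)

definition coeff where "coeff f n = L2_inner M f (e n) / of_real (w n)"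

lemma L2_inner_e: "L2_inner M f (e n) = coeff f n * of_real (w n)"
  using w_pos[of n] by (simp add: coeff_def)

lemma L2_inner_sum_e:
  assumes "f \<in> L2_fun M"
  shows "L2_inner M f (\<lambda>x. \<Sum>n\<in>I. a n * e n x) = (\<Sum>n\<in>I. cnj (a n) * coeff f n * of_real (w n))"
  using assms by (simp add: L2_inner_sum_right e L2_inner_e mult.assoc)

lemma coeff_sum:
  assumes "finite I"
  shows "coeff (\<lambda>x. \<Sum>n\<in>I. a n * e n x) n = (if n \<in> I then a n else 0)"
proof -
  have "L2_inner M (\<lambda>x. \<Sum>n\<in>I. a n * e n x) (e n) = (\<Sum>m\<in>I. if n = m then a m * of_real (w n) else 0)"
    by (subst L2_inner_sum_left) (auto simp: e orth intro!: sum.cong)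
  also have "\<dots> = (if n \<in> I then a n * of_real (w n) else 0)"
    using assms by simp
  finally show ?thesis
    using w_pos[of n] by (simp add: coeff_def)
qed

lemma L2_norm_sum:
  assumes "finite I"
  shows "(L2_norm M (\<lambda>x. \<Sum>n\<in>I. a n * e n x))\<^sup>2 = (\<Sum>n\<in>I. (cmod (a n))\<^sup>2 * w n)"
proof -
  have "of_real ((L2_norm M (\<lambda>x. \<Sum>n\<in>I. a n * e n x))\<^sup>2) = (\<Sum>n\<in>I. cnj (a n) * a n * complex_of_real (w n))"
    unfolding L2_inner_self[symmetric] using assms
    by (subst L2_inner_sum_e[OF sum_in_L2]) (simp add: coeff_sum)
  also have "\<dots> = of_real (\<Sum>n\<in>I. (cmod (a n))\<^sup>2 * w n)"
    unfolding of_real_sum by (intro sum.cong) (simp_all only: of_real_mult complex_norm_square mult.commute)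
  finally show ?thesis
    by (simp only: of_real_eq_iff)
qed

text \<open>Completing the square in each coefficient. Only the last sum depends on \<open>a\<close>
  and it vanishes for \<open>a = coeff f\<close>, which gives Bessel's inequality and the best
  approximation at once.\<close>

lemma L2_norm_diff_sum:
  assumes "finite I" "f \<in> L2_fun M"
  shows "(L2_norm M (\<lambda>x. f x - (\<Sum>n\<in>I. a n * e n x)))\<^sup>2
    = (L2_norm M f)\<^sup>2 - (\<Sum>n\<in>I. (cmod (coeff f n))\<^sup>2 * w n) + (\<Sum>n\<in>I. (cmod (a n - coeff f n))\<^sup>2 * w n)"
proof -
  define s where "s = (\<lambda>x. \<Sum>n\<in>I. a n * e n x)"
  have s: "s \<in> L2_fun M"
    unfolding s_def by (rule sum_in_L2)
  have fs: "L2_inner M f s = (\<Sum>n\<in>I. cnj (a n) * coeff f n * of_real (w n))"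
    unfolding s_def by (rule L2_inner_sum_e[OF assms(2)])
  have "of_real ((L2_norm M (\<lambda>x. f x - s x))\<^sup>2) = L2_inner M f f - L2_inner M f s - (L2_inner M s f - L2_inner M s s)"
    unfolding L2_inner_self[symmetric]
    by (simp add: L2_inner_diff_left L2_inner_diff_right L2_fun_diff s assms)
  also have "\<dots> = of_real ((L2_norm M f)\<^sup>2) - (L2_inner M f s + cnj (L2_inner M f s)) + of_real ((L2_norm M s)\<^sup>2)"
    by (simp add: L2_inner_self L2_inner_commute[of M s f])
  also have "L2_inner M f s + cnj (L2_inner M f s) = of_real (2 * (\<Sum>n\<in>I. Re (cnj (a n) * coeff f n) * w n))"
    unfolding complex_add_cnj by (simp add: fs)
  also have "(L2_norm M s)\<^sup>2 = (\<Sum>n\<in>I. (cmod (a n))\<^sup>2 * w n)"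
    unfolding s_def by (rule L2_norm_sum[OF assms(1)])
  finally have "(L2_norm M (\<lambda>x. f x - s x))\<^sup>2
      = (L2_norm M f)\<^sup>2 - 2 * (\<Sum>n\<in>I. Re (cnj (a n) * coeff f n) * w n) + (\<Sum>n\<in>I. (cmod (a n))\<^sup>2 * w n)"
    by (simp only: of_real_diff[symmetric] of_real_add[symmetric] of_real_eq_iff)
  moreover have "(cmod (a n - coeff f n))\<^sup>2 * w n
      = (cmod (a n))\<^sup>2 * w n - 2 * (Re (cnj (a n) * coeff f n) * w n) + (cmod (coeff f n))\<^sup>2 * w n" for n
    unfolding cmod_power2 by (simp add: power2_eq_square algebra_simps)
  ultimately show ?thesis
    by (simp add: s_def sum.distrib sum_subtractf sum_distrib_left)
qed

lemma Bessel_inequality: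
  assumes "finite I" "f \<in> L2_fun M"
  shows "(\<Sum>n\<in>I. (cmod (coeff f n))\<^sup>2 * w n) \<le> (L2_norm M f)\<^sup>2"
  using L2_norm_diff_sum[OF assms, of "coeff f"] zero_le_power2[of "L2_norm M (\<lambda>x. f x - (\<Sum>n\<in>I. coeff f n * e n x))"]
  by simp

lemma summable_coeff:
  assumes "f \<in> L2_fun M"
  shows "summable (\<lambda>n. (cmod (coeff f n))\<^sup>2 * w n)"
  by (rule summableI_nonneg_bounded[where x = "(L2_norm M f)\<^sup>2"])
    (use Bessel_inequality[OF _ assms] w_pos in \<open>auto simp: less_imp_le\<close>)

text \<open>Choosing the optimal coefficients and enlarging the index set can each only reduce the
  error.\<close>

lemma L2_norm_diff_coeff_le:
  assumes "f \<in> L2_fun M" "finite J" "I \<subseteq> J"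
  shows "L2_norm M (\<lambda>x. f x - (\<Sum>n\<in>J. coeff f n * e n x)) \<le> L2_norm M (\<lambda>x. f x - (\<Sum>n\<in>I. a n * e n x))"
proof (rule power2_le_imp_le[OF _ L2_norm_nonneg])
  have "finite I"
    using assms finite_subset by blast
  moreover have "(\<Sum>n\<in>I. (cmod (coeff f n))\<^sup>2 * w n) \<le> (\<Sum>n\<in>J. (cmod (coeff f n))\<^sup>2 * w n)"
    using assms w_pos by (intro sum_mono2) (auto simp: less_imp_le)
  moreover have "0 \<le> (\<Sum>n\<in>I. (cmod (a n - coeff f n))\<^sup>2 * w n)"
    using w_pos by (intro sum_nonneg) (auto simp: less_imp_le)
  ultimately show "(L2_norm M (\<lambda>x. f x - (\<Sum>n\<in>J. coeff f n * e n x)))\<^sup>2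
      \<le> (L2_norm M (\<lambda>x. f x - (\<Sum>n\<in>I. a n * e n x)))\<^sup>2"
    using assms by (simp add: L2_norm_diff_sum)
qed

text \<open>Fatou's lemma, applied to blocks of the pointwise convergent series, bounds the squared
  norm of each remainder by the tail of the weighted sum. Completeness of the space is not
  invoked.\<close>

lemma sums_imp_L2:
  assumes sums: "\<And>x. (\<lambda>n. a n * e n x) sums f x"
    and summable: "summable (\<lambda>n. (cmod (a n))\<^sup>2 * w n)"
  shows "f \<in> L2_fun M"
    and "(\<lambda>N. L2_norm M (\<lambda>x. f x - (\<Sum>n<N. a n * e n x))) \<longlonglongrightarrow> 0"
    and "coeff f = a"
proof -
  have e_meas [measurable]: "e n \<in> borel_measurable M" for n
    using e[of n] by (simp add: L2_fun_def)
  have f_meas [measurable]: "f \<in> borel_measurable M"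
    by (rule borel_measurable_LIMSEQ_metric[of "\<lambda>N x. \<Sum>n<N. a n * e n x"])
      (use sums in \<open>auto simp: sums_def\<close>)
  let ?t = "\<lambda>n. (cmod (a n))\<^sup>2 * w n"
  have t: "?t n \<ge> 0" for n
    using w_pos[of n] by simp
  have tail: "(\<integral>\<^sup>+x. ennreal ((cmod (f x - (\<Sum>n<N. a n * e n x)))\<^sup>2) \<partial>M) \<le> ennreal (\<Sum>n. ?t (n + N))" for N
  proof -
    let ?d = "\<lambda>K x. \<Sum>n\<in>{N..<N + K}. a n * e n x"
    have lim: "(\<lambda>K. ennreal ((cmod (?d K x))\<^sup>2)) \<longlonglongrightarrow> ennreal ((cmod (f x - (\<Sum>n<N. a n * e n x)))\<^sup>2)" for x
    proof -
      have "(\<lambda>K. \<Sum>n<N + K. a n * e n x) \<longlonglongrightarrow> f x"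
        using LIMSEQ_ignore_initial_segment[OF sums[of x, unfolded sums_def], of N] by (simp add: add.commute)
      then have "(\<lambda>K. (\<Sum>n<N + K. a n * e n x) - (\<Sum>n<N. a n * e n x)) \<longlonglongrightarrow> f x - (\<Sum>n<N. a n * e n x)"
        by (intro tendsto_intros)
      moreover have "(\<Sum>n<N + K. a n * e n x) - (\<Sum>n<N. a n * e n x) = ?d K x" for K
        using sum.atLeastLessThan_concat[of 0 N "N + K" "\<lambda>n. a n * e n x"] by (simp add: lessThan_atLeast0 diff_eq_eq add.commute)
      ultimately show ?thesis
        by (intro tendsto_ennrealI tendsto_intros) simp
    qed
    have "(\<integral>\<^sup>+x. ennreal ((cmod (f x - (\<Sum>n<N. a n * e n x)))\<^sup>2) \<partial>M)
        = (\<integral>\<^sup>+x. liminf (\<lambda>K. ennreal ((cmod (?d K x))\<^sup>2)) \<partial>M)"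
      by (intro nn_integral_cong lim_imp_Liminf[symmetric] lim) simp
    also have "\<dots> \<le> liminf (\<lambda>K. \<integral>\<^sup>+x. ennreal ((cmod (?d K x))\<^sup>2) \<partial>M)"
      by (intro nn_integral_liminf) measurable
    also have "\<dots> \<le> limsup (\<lambda>K. \<integral>\<^sup>+x. ennreal ((cmod (?d K x))\<^sup>2) \<partial>M)"
      by (intro Liminf_le_Limsup) simp
    also have "\<dots> \<le> ennreal (\<Sum>n. ?t (n + N))"
    proof (intro Limsup_bounded always_eventually allI)
      fix K
      have "(\<integral>\<^sup>+x. ennreal ((cmod (?d K x))\<^sup>2) \<partial>M) = ennreal (\<integral>x. (cmod (?d K x))\<^sup>2 \<partial>M)"
        using sum_in_L2[of a "{N..<N + K}"] by (intro nn_integral_eq_integral) (auto simp: L2_fun_def)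
      also have "(\<integral>x. (cmod (?d K x))\<^sup>2 \<partial>M) = (\<Sum>n\<in>{N..<N + K}. ?t n)"
        unfolding L2_norm_power2[symmetric] by (rule L2_norm_sum) simp
      also have "\<dots> = (\<Sum>n<K. ?t (n + N))"
        using sum.shift_bounds_nat_ivl[of ?t 0 N K] by (simp add: lessThan_atLeast0 add.commute)
      also have "ennreal \<dots> \<le> ennreal (\<Sum>n. ?t (n + N))"
        using t summable by (intro ennreal_leI sum_le_suminf summable_ignore_initial_segment) auto
      finally show "(\<integral>\<^sup>+x. ennreal ((cmod (?d K x))\<^sup>2) \<partial>M) \<le> ennreal (\<Sum>n. ?t (n + N))" .
    qed
    finally show ?thesis .
  qed
  \<comment> \<open>The tail bound with \<open>N = 0\<close> concerns \<open>f\<close> itself, the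
    partial sum being empty.\<close>
  show f: "f \<in> L2_fun M"
    unfolding L2_fun_def using tail[of 0]
    by (auto intro!: integrableI_bounded simp: le_less_trans[OF _ ennreal_less_top])
  have norm_le: "(L2_norm M (\<lambda>x. f x - (\<Sum>n<N. a n * e n x)))\<^sup>2 \<le> (\<Sum>n. ?t (n + N))" for N
  proof -
    have "ennreal ((L2_norm M (\<lambda>x. f x - (\<Sum>n<N. a n * e n x)))\<^sup>2) \<le> ennreal (\<Sum>n. ?t (n + N))"
      using tail[of N] L2_fun_diff[OF f sum_in_L2[of a "{..<N}"]]
      unfolding L2_norm_power2 by (subst (asm) nn_integral_eq_integral) (auto simp: L2_fun_def)
    then show ?thesis
      using t summable by (subst (asm) ennreal_le_iff) (auto intro!: suminf_nonneg summable_ignore_initial_segment)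
  qed
  have "(\<lambda>N. (L2_norm M (\<lambda>x. f x - (\<Sum>n<N. a n * e n x)))\<^sup>2) \<longlonglongrightarrow> 0"
    by (rule tendsto_sandwich[OF _ _ tendsto_const suminf_exist_split2[OF summable]])
      (use norm_le in auto)
  from tendsto_real_sqrt[OF this]
  show lim: "(\<lambda>N. L2_norm M (\<lambda>x. f x - (\<Sum>n<N. a n * e n x))) \<longlonglongrightarrow> 0"
    by (simp add: L2_norm_nonneg)
  show "coeff f = a"
  proof
    fix k
    have lim2: "(\<lambda>N. (L2_norm M (\<lambda>x. f x - (\<Sum>n<N. a n * e n x)))\<^sup>2) \<longlonglongrightarrow> 0\<^sup>2"
      by (intro tendsto_intros lim)
    \<comment> \<open>Once \<open>N\<close> exceeds \<open>k\<close>, a discrepancy in the k-th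
      coefficient is a fixed part of the approximation error, which tends to 0.\<close>
    have le: "(cmod (a k - coeff f k))\<^sup>2 * w k \<le> (L2_norm M (\<lambda>x. f x - (\<Sum>n<N. a n * e n x)))\<^sup>2" if "N > k" for N
    proof -
      have "(cmod (a k - coeff f k))\<^sup>2 * w k \<le> (\<Sum>n<N. (cmod (a n - coeff f n))\<^sup>2 * w n)"
        using that w_pos by (intro member_le_sum) (auto simp: less_imp_le)
      also have "\<dots> \<le> (L2_norm M (\<lambda>x. f x - (\<Sum>n<N. a n * e n x)))\<^sup>2"
        using Bessel_inequality[OF _ f, of "{..<N}"] by (simp add: L2_norm_diff_sum f)
      finally show ?thesis .
    qed
    have "(cmod (a k - coeff f k))\<^sup>2 * w k \<le> 0\<^sup>2"
      by (rule LIMSEQ_le_const[OF lim2]) (use le in \<open>auto intro!: exI[of _ "Suc k"]\<close>)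
    then show "coeff f k = a k"
      using w_pos[of k] by (simp add: mult_le_0_iff)
  qed
qed

lemma L2_inner_sums:
  assumes f: "\<And>x. (\<lambda>n. a n * e n x) sums f x" "summable (\<lambda>n. (cmod (a n))\<^sup>2 * w n)"
    and g: "\<And>x. (\<lambda>n. b n * e n x) sums g x" "summable (\<lambda>n. (cmod (b n))\<^sup>2 * w n)"
  shows "(\<lambda>n. a n * cnj (b n) * of_real (w n)) sums L2_inner M f g"
proof -
  note F = sums_imp_L2[OF f] and G = sums_imp_L2[OF g]
  let ?s = "\<lambda>a N x. \<Sum>n<N. a n * e n x"
  have s: "?s a N \<in> L2_fun M" for a N
    by (rule sum_in_L2)
  \<comment> \<open>By orthogonality both mixed terms and the product of the partial sums all equal
    the same finite sum, so the error is the inner product of the two remainders.\<close>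
  have eq: "L2_inner M f g - (\<Sum>n<N. a n * cnj (b n) * of_real (w n))
      = L2_inner M (\<lambda>x. f x - ?s a N x) (\<lambda>x. g x - ?s b N x)" for N
  proof -
    have "L2_inner M f (?s b N) = (\<Sum>n<N. a n * cnj (b n) * of_real (w n))"
      by (simp add: L2_inner_sum_e F mult_ac)
    moreover have "L2_inner M (?s a N) g = (\<Sum>n<N. a n * cnj (b n) * of_real (w n))"
      by (subst L2_inner_commute) (simp add: L2_inner_sum_e G mult_ac)
    moreover have "L2_inner M (?s a N) (?s b N) = (\<Sum>n<N. a n * cnj (b n) * of_real (w n))"
      by (simp add: L2_inner_sum_e s coeff_sum mult_ac)
    ultimately show ?thesis
      by (simp add: L2_inner_diff_left L2_inner_diff_right L2_fun_diff F(1) G(1) s)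
  qed
  have "(\<lambda>N. (L2_norm M (\<lambda>x. f x - ?s a N x))\<^sup>2 + (L2_norm M (\<lambda>x. g x - ?s b N x))\<^sup>2) \<longlonglongrightarrow> 0\<^sup>2 + 0\<^sup>2"
    by (intro tendsto_intros F(2) G(2))
  then have lim: "(\<lambda>N. (L2_norm M (\<lambda>x. f x - ?s a N x))\<^sup>2 + (L2_norm M (\<lambda>x. g x - ?s b N x))\<^sup>2) \<longlonglongrightarrow> 0"
    by simp
  have "(\<lambda>N. L2_inner M f g - (\<Sum>n<N. a n * cnj (b n) * of_real (w n))) \<longlonglongrightarrow> 0"
    unfolding eq
    by (rule Lim_null_comparison[OF always_eventually lim])
      (intro allI norm_L2_inner_le L2_fun_diff F(1) G(1) s)
  from tendsto_diff[OF tendsto_const this, of "L2_inner M f g"] show ?thesis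
    by (simp add: sums_def)
qed

end

section \<open>The space of entire functions\<close>

lemma fps_coeff_sums:
  assumes "\<phi> holomorphic_on UNIV"
  shows "(\<lambda>n. fps_nth (fps_expansion \<phi> 0) n * z ^ n) sums \<phi> z"
  using assms by (intro has_fps_expansion_imp_sums_complex[where r = \<infinity>] has_fps_expansion_fps_expansion[of UNIV]) auto

lemma entire_if_summable:
  fixes c :: "nat \<Rightarrow> complex"
  assumes "\<And>z. summable (\<lambda>n. c n * z ^ n)"
  shows "(\<lambda>z. \<Sum>n. c n * z ^ n) holomorphic_on UNIV"
    and "fps_nth (fps_expansion (\<lambda>z. \<Sum>n. c n * z ^ n) 0) n = c n"
proof -
  have r: "fps_conv_radius (Abs_fps c) = \<infinity>"
    unfolding fps_conv_radius_def using assms by (intro conv_radius_inftyI'') simp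
  have eq: "(\<lambda>z. \<Sum>n. c n * z ^ n) = eval_fps (Abs_fps c)"
    by (simp add: eval_fps_def fun_eq_iff)
  show "(\<lambda>z. \<Sum>n. c n * z ^ n) holomorphic_on UNIV"
    unfolding eq by (intro holomorphic_intros) (simp add: r)
  have "eval_fps (Abs_fps c) has_fps_expansion Abs_fps c"
    by (rule eval_fps_has_fps_expansion) (simp add: r)
  then show "fps_nth (fps_expansion (\<lambda>z. \<Sum>n. c n * z ^ n) 0) n = c n"
    unfolding eq by (simp add: fps_expansion_eqI)
qed

section \<open>The monomials and the Hilbert space of entire functions\<close>

context
  fixes \<eta> \<sigma> :: real
  assumes \<eta>: "\<eta> > 0" and \<sigma>: "\<sigma> > 0"
begin

definition fock_weight :: "nat \<Rightarrow> real" where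
  "fock_weight n = fact n * gen_factorial \<sigma> (- \<eta>) n"

lemma fock_weight_pos: "fock_weight n > 0"
  using \<eta> \<sigma> by (auto simp: fock_weight_def gen_factorial_def intro!: prod_pos mult_pos_pos add_pos_nonneg)

lemma fock_weight_Suc: "fock_weight (Suc n) = (real n + 1) * (\<sigma> + real n * \<eta>) * fock_weight n"
  by (simp add: fock_weight_def gen_factorial_def algebra_simps)

lemma power_in_L2_fun: "(\<lambda>z. z ^ n) \<in> L2_fun (lambda_measure \<eta> \<sigma>)"
  unfolding L2_fun_def
  by (auto intro!: integrableI_bounded
      simp: norm_power power_mult[symmetric] mult.commute[of _ 2] nn_integral_lambda_measure_norm_power[OF \<eta> \<sigma>])

lemma L2_norm_power: "(L2_norm (lambda_measure \<eta> \<sigma>) (\<lambda>z. z ^ n))\<^sup>2 = fock_weight n"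
proof -
  have "ennreal ((L2_norm (lambda_measure \<eta> \<sigma>) (\<lambda>z. z ^ n))\<^sup>2) = (\<integral>\<^sup>+z. ennreal ((cmod (z ^ n))\<^sup>2) \<partial>lambda_measure \<eta> \<sigma>)"
    unfolding L2_norm_power2 using power_in_L2_fun[of n]
    by (intro nn_integral_eq_integral[symmetric]) (auto simp: L2_fun_def)
  also have "\<dots> = ennreal (fock_weight n)"
    using nn_integral_lambda_measure_norm_power[OF \<eta> \<sigma>, of n]
    by (simp add: fock_weight_def norm_power power_mult[symmetric] mult.commute)
  finally show ?thesis
    using fock_weight_pos[of n] by (subst (asm) ennreal_inj) auto
qed

text \<open>A rotation by an angle whose multiple by the difference of degrees is a right angle
  reproduces the inner product multiplied by the imaginary unit, so it must vanish.\<close>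

lemma L2_inner_power_eq_0:
  assumes "m \<noteq> n"
  shows "L2_inner (lambda_measure \<eta> \<sigma>) (\<lambda>z. z ^ m) (\<lambda>z. z ^ n) = 0"
proof -
  define k where "k = int m - int n"
  define c where "c = cis (pi / (2 * of_int k))"
  have k: "k \<noteq> 0"
    using assms by (simp add: k_def)
  let ?J = "L2_inner (lambda_measure \<eta> \<sigma>) (\<lambda>z. z ^ m) (\<lambda>z. z ^ n)"
  \<comment> \<open>The angle stays within a quarter turn, so \<open>c\<close> has nonnegative real
    part and avoids the excluded value -1.\<close>
  have "\<bar>pi / (2 * of_int k)\<bar> \<le> pi / 2"
  proof -
    have "\<bar>pi / (2 * of_int k)\<bar> = pi / (2 * of_int \<bar>k\<bar>)"
      by (simp add: abs_mult)
    also have "\<dots> \<le> pi / 2"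
      using k by (intro divide_left_mono) auto
    finally show ?thesis .
  qed
  then have "cos (pi / (2 * of_int k)) \<ge> 0"
    unfolding abs_le_iff by (intro cos_ge_zero) linarith+
  then have "Re c \<noteq> -1"
    by (simp add: c_def)
  then have rot: "distr (lambda_measure \<eta> \<sigma>) borel (\<lambda>z. c * z) = lambda_measure \<eta> \<sigma>"
    by (intro lambda_measure_rotation \<eta> \<sigma>) (simp_all add: c_def)
  have [measurable]: "cnj \<in> borel_measurable borel"
    by (intro borel_measurable_continuous_onI continuous_intros)
  have "?J = (\<integral>z. z ^ m * cnj (z ^ n) \<partial>distr (lambda_measure \<eta> \<sigma>) borel (\<lambda>z. c * z))"
    by (simp add: rot L2_inner_def)
  also have "\<dots> = (\<integral>z. (c * z) ^ m * cnj ((c * z) ^ n) \<partial>lambda_measure \<eta> \<sigma>)"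
    by (rule integral_distr) measurable
  also have "\<dots> = (\<integral>z. c ^ m * cnj (c ^ n) * (z ^ m * cnj (z ^ n)) \<partial>lambda_measure \<eta> \<sigma>)"
    by (simp add: power_mult_distrib mult_ac)
  also have "\<dots> = c ^ m * cnj (c ^ n) * ?J"
    by (simp add: L2_inner_def)
  also have "c ^ m * cnj (c ^ n) = cis (pi / 2)"
  proof -
    have "c ^ m * cnj (c ^ n) = cis (real m * (pi / (2 * of_int k)) - real n * (pi / (2 * of_int k)))"
      unfolding c_def Complex.DeMoivre cis_cnj cis_mult diff_conv_add_uminus by (rule refl)
    also have "real m * (pi / (2 * of_int k)) - real n * (pi / (2 * of_int k)) = of_int k * (pi / (2 * of_int k))"
      by (subst left_diff_distrib[symmetric]) (simp add: k_def)
    also have "\<dots> = pi / 2"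
      using k by simp
    finally show ?thesis .
  qed
  finally have "?J = \<i> * ?J"
    by simp
  then have "(1 - \<i>) * ?J = 0"
    by (simp add: algebra_simps)
  then show ?thesis
    by (auto simp: complex_eq_iff)
qed

lemma L2_orthogonal_power: "L2_orthogonal (lambda_measure \<eta> \<sigma>) (\<lambda>n z. z ^ n) fock_weight"
proof
  show "L2_inner (lambda_measure \<eta> \<sigma>) (\<lambda>z. z ^ m) (\<lambda>z. z ^ n) = (if m = n then of_real (fock_weight n) else 0)" for m n
    using L2_inner_power_eq_0[of m n] by (auto simp: L2_inner_self L2_norm_power simp del: of_real_power)
qed (rule power_in_L2_fun fock_weight_pos)+

interpretation L2_orthogonal "lambda_measure \<eta> \<sigma>" "\<lambda>n z. z ^ n" fock_weight
  by (rule L2_orthogonal_power)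

lemma fock_space_iff:
  "\<phi> \<in> fock_space \<eta> \<sigma> \<longleftrightarrow> \<phi> holomorphic_on UNIV \<and>
     summable (\<lambda>n. (cmod (fps_nth (fps_expansion \<phi> 0) n))\<^sup>2 * fock_weight n)"
  by (simp add: fock_space_def fock_weight_def mult.assoc)

lemma fock_space_sums:
  assumes "\<phi> \<in> fock_space \<eta> \<sigma>"
  shows "(\<lambda>n. fps_nth (fps_expansion \<phi> 0) n * z ^ n) sums \<phi> z"
    and "summable (\<lambda>n. (cmod (fps_nth (fps_expansion \<phi> 0) n))\<^sup>2 * fock_weight n)"
  using assms by (auto simp: fock_space_iff fps_coeff_sums)

lemma fock_space_L2:
  assumes "\<phi> \<in> fock_space \<eta> \<sigma>"
  shows "\<phi> \<in> L2_fun (lambda_measure \<eta> \<sigma>)"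
    and "(\<lambda>N. L2_norm (lambda_measure \<eta> \<sigma>) (\<lambda>z. \<phi> z - (\<Sum>n<N. fps_nth (fps_expansion \<phi> 0) n * z ^ n))) \<longlonglongrightarrow> 0"
    and "coeff \<phi> = fps_nth (fps_expansion \<phi> 0)"
  using sums_imp_L2[OF fock_space_sums[OF assms]] by blast+

lemma summable_power_div_fock_weight: "summable (\<lambda>n. x ^ n / fock_weight n)"
proof (rule summable_ratio_test)
  \<comment> \<open>The bound drops \<open>real n * \<eta>\<close> from the growth factor of the
    weight; \<open>(real n + 1) * \<sigma>\<close> already exceeds
    \<open>2 * \<bar>x\<bar>\<close>.\<close>
  fix n assume "n \<ge> nat \<lceil>2 * \<bar>x\<bar> / \<sigma>\<rceil>"
  then have "2 * \<bar>x\<bar> / \<sigma> \<le> real n + 1"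
    by linarith
  then have "2 * \<bar>x\<bar> \<le> (real n + 1) * \<sigma>"
    using \<sigma> by (simp add: field_simps)
  also have "\<dots> \<le> (real n + 1) * (\<sigma> + real n * \<eta>)"
    using \<eta> by (intro mult_left_mono) auto
  finally have 1: "\<bar>x\<bar> / ((real n + 1) * (\<sigma> + real n * \<eta>)) \<le> 1 / 2"
    using \<eta> \<sigma> by (simp add: divide_le_eq add_pos_nonneg)
  have pos: "\<sigma> + real n * \<eta> > 0"
    using \<eta> \<sigma> by (simp add: add_pos_nonneg)
  have "norm (x ^ Suc n / fock_weight (Suc n))
      = \<bar>x\<bar> / ((real n + 1) * (\<sigma> + real n * \<eta>)) * (\<bar>x\<bar> ^ n / fock_weight n)"
    using pos fock_weight_pos[of n] by (simp add: fock_weight_Suc abs_mult power_abs)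
  also have "\<dots> \<le> 1 / 2 * (\<bar>x\<bar> ^ n / fock_weight n)"
    using 1 fock_weight_pos[of n] by (intro mult_right_mono) auto
  also have "\<dots> = 1 / 2 * norm (x ^ n / fock_weight n)"
    using fock_weight_pos[of n] by (simp add: power_abs)
  finally show "norm (x ^ Suc n / fock_weight (Suc n)) \<le> 1 / 2 * norm (x ^ n / fock_weight n)" .
qed simp

text \<open>Splitting each term with the square root of the weight bounds it by a weighted square
  plus a term of the reproducing kernel on the diagonal. Square-summable coefficients therefore
  define entire functions.\<close>

lemma summable_power_series_if_weighted:
  assumes "summable (\<lambda>n. (cmod (c n))\<^sup>2 * fock_weight n)"
  shows "summable (\<lambda>n. c n * z ^ n)"
proof (rule summable_comparison_test'[OF summable_add[OF assms summable_power_div_fock_weight[of "(cmod z)\<^sup>2"]]])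
  fix n
  let ?r = "sqrt (fock_weight n)"
  have w: "fock_weight n > 0" by (rule fock_weight_pos)
  have "norm (c n * z ^ n) = (cmod (c n) * ?r) * (cmod z ^ n / ?r)"
    using w by (simp add: norm_mult norm_power)
  also have "\<dots> \<le> (cmod (c n) * ?r)\<^sup>2 + (cmod z ^ n / ?r)\<^sup>2"
  proof -
    have "a * b \<le> a\<^sup>2 + b\<^sup>2" if "a \<ge> 0" "b \<ge> 0" for a b :: real
      using sum_squares_bound[of a b] mult_nonneg_nonneg[OF that] by linarith
    then show ?thesis
      using w by (metis fock_weight_pos less_imp_le mult_nonneg_nonneg divide_nonneg_nonneg
          norm_ge_zero real_sqrt_ge_zero zero_le_power)
  qed
  also have "\<dots> = (cmod (c n))\<^sup>2 * fock_weight n + ((cmod z)\<^sup>2) ^ n / fock_weight n"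
    using w by (simp add: power_mult_distrib power_divide flip: power_mult) (simp add: mult.commute)
  finally show "norm (c n * z ^ n) \<le> (cmod (c n))\<^sup>2 * fock_weight n + ((cmod z)\<^sup>2) ^ n / fock_weight n" .
qed

lemma poly_eq_sum: "poly p = (\<lambda>z::complex. \<Sum>n<Suc (degree p). Polynomial.coeff p n * z ^ n)"
  by (simp add: poly_altdef fun_eq_iff lessThan_Suc_atMost)

lemma sum_in_range_poly: "(\<lambda>z::complex. \<Sum>n<N. a n * z ^ n) \<in> range poly"
  by (rule range_eqI[of _ _ "\<Sum>n<N. Polynomial.monom (a n) n"]) (simp add: fun_eq_iff poly_sum poly_monom)

lemma poly_in_L2_fun: "poly p \<in> L2_fun (lambda_measure \<eta> \<sigma>)"
  unfolding poly_eq_sum by (rule sum_in_L2)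

lemma fock_inner_eq_L2_inner:
  assumes "\<phi> \<in> fock_space \<eta> \<sigma>" "\<psi> \<in> fock_space \<eta> \<sigma>"
  shows "fock_inner \<eta> \<sigma> \<phi> \<psi> = L2_inner (lambda_measure \<eta> \<sigma>) \<phi> \<psi>"
  using L2_inner_sums[OF fock_space_sums[OF assms(1)] fock_space_sums[OF assms(2)]]
  by (simp add: fock_inner_def fock_weight_def sums_iff mult.assoc)

text \<open>Almost everywhere equal functions have the same inner products with monomials. These
  determine the Taylor coefficients, hence the entire functions at every point.\<close>

lemma inj_on_L2_class_fock_space: "inj_on (L2_class (lambda_measure \<eta> \<sigma>)) (fock_space \<eta> \<sigma>)"
proof (rule inj_onI)
  fix \<phi> \<psi> assume \<phi>: "\<phi> \<in> fock_space \<eta> \<sigma>" and \<psi>: "\<psi> \<in> fock_space \<eta> \<sigma>"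
    and eq: "L2_class (lambda_measure \<eta> \<sigma>) \<phi> = L2_class (lambda_measure \<eta> \<sigma>) \<psi>"
  note F = fock_space_L2[OF \<phi>] and G = fock_space_L2[OF \<psi>]
  have ae: "AE z in lambda_measure \<eta> \<sigma>. \<phi> z = \<psi> z"
    using eq by (simp add: L2_class_eq_iff F(1) G(1))
  have "L2_inner (lambda_measure \<eta> \<sigma>) \<phi> (\<lambda>z. z ^ n) = L2_inner (lambda_measure \<eta> \<sigma>) \<psi> (\<lambda>z. z ^ n)" for n
    unfolding L2_inner_def
  proof (rule integral_cong_AE)
    show "AE z in lambda_measure \<eta> \<sigma>. \<phi> z * cnj (z ^ n) = \<psi> z * cnj (z ^ n)"
      using ae by eventually_elim simp
  qed (rule borel_measurable_integrable[OF integrable_L2_inner] F G power_in_L2_fun)+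
  then have "coeff \<phi> = coeff \<psi>"
    by (simp add: coeff_def fun_eq_iff)
  then have "fps_nth (fps_expansion \<phi> 0) = fps_nth (fps_expansion \<psi> 0)"
    by (simp only: F(3) G(3))
  then show "\<phi> = \<psi>"
    using fock_space_sums(1)[OF \<phi>] fock_space_sums(1)[OF \<psi>] by (auto simp: fun_eq_iff intro: sums_unique2)
qed

text \<open>Taylor polynomials approximate each entire function of the space. Conversely, the
  expansion coefficients of a limit of polynomials define an entire function, and the limit agrees
  with it almost everywhere.\<close>

lemma L2_class_fock_space_eq_closure:
  "L2_class (lambda_measure \<eta> \<sigma>) ` fock_space \<eta> \<sigma>
    = L2_topology (lambda_measure \<eta> \<sigma>) closure_of
        (L2_class (lambda_measure \<eta> \<sigma>) ` range (poly :: complex poly \<Rightarrow> complex \<Rightarrow> complex))"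
    (is "?c ` _ = _ closure_of ?P")
proof -
  let ?M = "lambda_measure \<eta> \<sigma>"
  interpret L2: Metric_space "L2_space ?M" "L2_dist ?M"
    by (rule Metric_space_L2)
  have space: "?c f \<in> L2_space ?M" if "f \<in> L2_fun ?M" for f
    using that by (simp add: L2_space_def)
  have closure: "L2_topology ?M closure_of ?P = {A \<in> L2_space ?M. \<forall>r>0. \<exists>B\<in>?P. B \<in> L2.mball A r}"
    unfolding L2_topology_def by (rule L2.metric_closure_of)
  show ?thesis
    unfolding closure
  proof (intro antisym subsetI CollectI conjI allI impI)
    fix A assume "A \<in> ?c ` fock_space \<eta> \<sigma>"
    then obtain \<phi> where \<phi>: "\<phi> \<in> fock_space \<eta> \<sigma>" and A: "A = ?c \<phi>"
      by blast
    note F = fock_space_L2[OF \<phi>]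
    let ?s = "\<lambda>N z. \<Sum>n<N. fps_nth (fps_expansion \<phi> 0) n * z ^ n"
    show "A \<in> L2_space ?M"
      by (simp add: A space F)
    fix r :: real assume "r > 0"
    with F(2) obtain N where N: "L2_norm ?M (\<lambda>z. \<phi> z - ?s N z) < r"
      by (metis (no_types, lifting) eventually_sequentially order_refl order_tendstoD(2))
    have "?c (?s N) \<in> L2.mball A r"
      using N sum_in_L2[of _ "{..<N}"] F(1) by (simp add: A L2_dist_class space)
    then show "\<exists>B\<in>?P. B \<in> L2.mball A r"
      using sum_in_range_poly[of _ N] by blast
  next
    fix A assume "A \<in> {A \<in> L2_space ?M. \<forall>r>0. \<exists>B\<in>?P. B \<in> L2.mball A r}"
    then obtain f where f: "f \<in> L2_fun ?M" and A: "A = ?c f"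
      and approx: "\<And>r. r > 0 \<Longrightarrow> \<exists>B\<in>?P. B \<in> L2.mball A r"
      by (auto simp: L2_space_def)
    define \<phi> where "\<phi> = (\<lambda>z. \<Sum>n. coeff f n * z ^ n)"
    have summable: "summable (\<lambda>n. (cmod (coeff f n))\<^sup>2 * fock_weight n)"
      by (rule summable_coeff[OF f])
    note entire = entire_if_summable[OF summable_power_series_if_weighted[OF summable], folded \<phi>_def]
    have \<phi>: "\<phi> \<in> fock_space \<eta> \<sigma>"
      by (simp add: fock_space_iff entire summable)
    note F = fock_space_L2[OF \<phi>, unfolded entire(2)]
    let ?s = "\<lambda>N z. \<Sum>n<N. coeff f n * z ^ n"
    have "L2_norm ?M (\<lambda>z. f z - \<phi> z) \<le> 0 + r" if r: "r > 0" for r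
    proof -
      obtain q where q: "L2_norm ?M (\<lambda>z. f z - poly q z) < r / 2"
        using approx[of "r / 2"] r by (auto simp: A L2_dist_class f poly_in_L2_fun)
      obtain N0 where N0: "\<And>N. N \<ge> N0 \<Longrightarrow> L2_norm ?M (\<lambda>z. \<phi> z - ?s N z) < r / 2"
        using order_tendstoD(2)[OF F(2), of "r / 2"] r by (auto simp: eventually_sequentially)
      \<comment> \<open>The \<open>Suc\<close> is needed because sums run below \<open>N\<close>,
        while \<open>q\<close> has coefficients up to its degree. Its index range then lies in that
        of the partial sum, which approximates \<open>f\<close> at least as well as
        \<open>q\<close>.\<close>
      define N where "N = max N0 (Suc (degree q))"
      have "L2_norm ?M (\<lambda>z. f z - ?s N z) \<le> L2_norm ?M (\<lambda>z. f z - poly q z)"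
        unfolding poly_eq_sum by (rule L2_norm_diff_coeff_le[OF f]) (auto simp: N_def)
      moreover have "L2_norm ?M (\<lambda>z. (f z - ?s N z) - (\<phi> z - ?s N z))
          \<le> L2_norm ?M (\<lambda>z. f z - ?s N z) + L2_norm ?M (\<lambda>z. \<phi> z - ?s N z)"
        by (intro L2_norm_triangle L2_fun_diff f F sum_in_L2)
      ultimately show ?thesis
        using q N0[of N] by (simp add: N_def)
    qed
    then have "L2_norm ?M (\<lambda>z. f z - \<phi> z) \<le> 0"
      by (rule field_le_epsilon)
    then have "L2_dist ?M (?c f) (?c \<phi>) = 0"
      using L2_norm_nonneg[of ?M "\<lambda>z. f z - \<phi> z"] by (simp add: L2_dist_class f F)
    then have "A = ?c \<phi>"
      by (simp add: A space f F)
    with \<phi> show "A \<in> ?c ` fock_space \<eta> \<sigma>"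
      by blast
  qed
qed

end

text \<open>The identification with a closed subspace is expressed by the map to classes: injective,
  preserving inner products, with image the closure of the polynomial classes. The Bessel formula is
  restricted to nonzero points; continuity of the density at 0 makes its value there the limit of
  the formula.\<close>

theorem proposition2p1:
  fixes \<eta> \<sigma> :: real
  assumes "\<eta> > 0" and "\<sigma> > 0"
  shows "fock_space \<eta> \<sigma> \<subseteq> L2_fun (lambda_measure \<eta> \<sigma>)
    \<and> range (poly :: complex poly \<Rightarrow> complex \<Rightarrow> complex) \<subseteq> L2_fun (lambda_measure \<eta> \<sigma>)
    \<and> inj_on (L2_class (lambda_measure \<eta> \<sigma>)) (fock_space \<eta> \<sigma>)
    \<and> (\<forall>\<phi>\<in>fock_space \<eta> \<sigma>. \<forall>\<psi>\<in>fock_space \<eta> \<sigma>.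
         fock_inner \<eta> \<sigma> \<phi> \<psi> = L2_inner (lambda_measure \<eta> \<sigma>) \<phi> \<psi>)
    \<and> L2_class (lambda_measure \<eta> \<sigma>) ` fock_space \<eta> \<sigma>
        = L2_topology (lambda_measure \<eta> \<sigma>) closure_of
            (L2_class (lambda_measure \<eta> \<sigma>) ` range (poly :: complex poly \<Rightarrow> complex \<Rightarrow> complex))
    \<and> lambda_measure \<eta> \<sigma> = density lborel (lambda_density \<eta> \<sigma>)
    \<and> (\<forall>z. z \<noteq> 0 \<longrightarrow> lambda_density \<eta> \<sigma> z =
         ennreal (2 * \<eta> powr (- (1 / 2) * (1 + \<sigma> / \<eta>)) / (pi * Gamma (\<sigma> / \<eta>))
           * cmod z powr (\<sigma> / \<eta> - 1) * bessel_K (1 - \<sigma> / \<eta>) (2 * \<eta> powr (- (1 / 2)) * cmod z)))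
    \<and> isCont (lambda_density \<eta> \<sigma>) 0"
proof -
  have "fock_space \<eta> \<sigma> \<subseteq> L2_fun (lambda_measure \<eta> \<sigma>)"
    using fock_space_L2(1)[OF assms] by blast
  moreover have "range (poly :: complex poly \<Rightarrow> complex \<Rightarrow> complex) \<subseteq> L2_fun (lambda_measure \<eta> \<sigma>)"
    using poly_in_L2_fun[OF assms] by blast
  ultimately show ?thesis
    using inj_on_L2_class_fock_space[OF assms] fock_inner_eq_L2_inner[OF assms]
      L2_class_fock_space_eq_closure[OF assms] lambda_measure_eq_density[OF assms]
      lambda_density_eq_bessel_K[OF assms] isCont_lambda_density_0[OF assms(1), of \<sigma>]
    by blast
qed

end
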